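(* Let $B^0\subseteq S$ and let $\kappa:\mathbb{N}\to\mathbb{N}$ be any function. Define recursively $B^k:=(B^{k-1})^{*\kappa(k)}$ for all $k\in\mathbb{N}$, and $F:=\bigcap_{k\in\mathbb{N}_0}B^k$. Then $\tau_0(F)$ is optimal in $\mathcal{T}(B^0)$, i.e. $\tau_0(F)\in\mathcal{T}(B^0)$ and for all $z\in S$ $$\mathrm{E}(X_{\tau_0(F)}\mid Z_0=z)=\sup_{\tau\in\mathcal{T}(B^0)}\mathrm{E}(X_\tau\mid Z_0=z).$$ Moreover, $$\tau_0(B^k)\le\tau_0(B^{k+1})\quad\text{for all }k\in\mathbb{N}_0,$$ $$\lim_{k\to\infty}\tau_0(B^k)=\tau_0(F),$$ $$\mathrm{E}(X_{\tau_0(B^k)}\mid Z_0=z)\le\mathrm{E}(X_{\tau_0(B^{k+1})}\mid Z_0=z)\quad\text{for all }k\in\mathbb{N}_0\text{ and all }z\in S.$$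
   Context: $\mathbb{N}=\{1,2,\dots\}$, $\mathbb{N}_0=\mathbb{N}\cup\{0\}$. $(Z_n)_{n\in\mathbb{N}_0}$ is a time-homogeneous Markov chain on a countable state space $S$, on a probability space with filtration $(\mathcal{A}_n)_{n\in\mathbb{N}_0}$ (the chain is Markov with respect to this filtration); $\mathrm{E}(\cdot\mid Z_0=z)$ is expectation under the law $P_z$ of the chain started at $z\in S$. Let $g:S\to\mathbb{R}$ and $\alpha:S\to[0,1]$. $\mathcal{T}$ is the set of all stopping rules (stopping times with respect to $(\mathcal{A}_n)$ with values in $\mathbb{N}_0\cup\{\infty\}$). Pay-off: $X_n:=\left(\prod_{i=0}^{n-1}\alpha(Z_i)\right)g(Z_n)$ for $n\in\mathbb{N}_0$ (empty product $=1$), $X_\infty:=\limsup_n X_n$. (The formal expression $\left(\prod_{i=0}^{\tau-1}\alpha(Z_i)\right)g(Z_\tau)$ is read as $X_\infty$ on $\{\tau=\infty\}$.) Standing assumptions: $\mathrm{E}(X_\tau\mid Z_0=z)$ exists for all $\tau\in\mathcal{T}$ and $z\in S$; and for all $z\in S$ and all non-decreasing sequences $(\sigma_n)_{n\in\mathbb{N}_0}$ of stopping rules, $\mathrm{E}(X_{\lim_{n\to\infty}\sigma_n}\mid Z_0=z)=\lim_{n\to\infty}\mathrm{E}(X_{\sigma_n}\mid Z_0=z)$. For $B\subseteq S$: $\mathcal{T}(B):=\{\tau\in\mathcal{T}: Z_\tau\in B\text{ on }\{\tau<\infty\}\}$. For $\sigma\in\mathcal{T}$ (in particular for constant $\sigma\in\mathbb{N}_0$):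 $\tau_\sigma(B):=\inf\{k\ge\sigma: Z_k\in B\}$, with $\inf\emptyset=\infty$. For $k\in\mathbb{N}$: $B^{*k}:=\{z\in B: g(z)\ge \mathrm{E}(X_{\tau_l(B)}\mid Z_0=z)\text{ for all }l=1,\dots,k\}$. *)

theory Defs
  imports "HOL-Probability.Probability"
begin

text \<open>
  The countable state space \<open>S\<close> is a type of class \<open>countable\<close> with its discrete
  \<open>\<sigma>\<close>-algebra. The chain is given as a Markov family: one process \<open>Z\<close> on one filtered
  measurable space \<open>M\<close> (only \<open>space M\<close> and \<open>sets M\<close> matter), together with
  a law \<open>P z\<close> for every starting state \<open>z\<close>, under which \<open>Z\<close> is Markov with respect to
  the filtration \<open>\<A>\<close> with the transition kernel \<open>K\<close>.
\<close>

locale markov_chain = filtration "space M" \<A>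
  for M :: "'w measure" and \<A> :: "nat \<Rightarrow> 'w measure" +
  fixes P :: "'s::countable \<Rightarrow> 'w measure"
    and K :: "'s \<Rightarrow> 's pmf"
    and Z :: "nat \<Rightarrow> 'w \<Rightarrow> 's"
  assumes subalgebra_filtration: "\<And>n. subalgebra M (\<A> n)"
    and prob_space_law: "\<And>z. prob_space (P z)"
    and sets_law: "\<And>z. sets (P z) = sets M"
    and adapted: "\<And>n. Z n \<in> measurable (\<A> n) (count_space UNIV)"
    and start: "\<And>z. AE \<omega> in P z. Z 0 \<omega> = z"
    and markov: "\<And>z n y. AE \<omega> in P z.
      real_cond_exp (P z) (\<A> n) (\<lambda>\<omega>. indicator {y} (Z (Suc n) \<omega>)) \<omega> = pmf (K (Z n \<omega>)) y"

definition stopping_rule :: "(nat \<Rightarrow> 'w measure) \<Rightarrow> ('w \<Rightarrow> enat) \<Rightarrow> bool" where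
  "stopping_rule \<A> \<tau> \<longleftrightarrow> (\<forall>n. Measurable.pred (\<A> n) (\<lambda>\<omega>. \<tau> \<omega> \<le> enat n))"

definition stopping_rules_in ::
  "'w measure \<Rightarrow> (nat \<Rightarrow> 'w measure) \<Rightarrow> (nat \<Rightarrow> 'w \<Rightarrow> 's) \<Rightarrow> 's set \<Rightarrow> ('w \<Rightarrow> enat) set" where
  "stopping_rules_in M \<A> Z B =
    {\<tau>. stopping_rule \<A> \<tau> \<and> (\<forall>\<omega>\<in>space M. \<forall>n. \<tau> \<omega> = enat n \<longrightarrow> Z n \<omega> \<in> B)}"

definition payoff ::
  "('s \<Rightarrow> real) \<Rightarrow> ('s \<Rightarrow> real) \<Rightarrow> (nat \<Rightarrow> 'w \<Rightarrow> 's) \<Rightarrow> nat \<Rightarrow> 'w \<Rightarrow> real" where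
  "payoff \<alpha> g Z n \<omega> = (\<Prod>i<n. \<alpha> (Z i \<omega>)) * g (Z n \<omega>)"

text \<open>The limes superior at time \<open>\<infinity>\<close> may be infinite, so stopped payoffs are extended reals.\<close>

definition stopped_payoff ::
  "('s \<Rightarrow> real) \<Rightarrow> ('s \<Rightarrow> real) \<Rightarrow> (nat \<Rightarrow> 'w \<Rightarrow> 's) \<Rightarrow> ('w \<Rightarrow> enat) \<Rightarrow> 'w \<Rightarrow> ereal" where
  "stopped_payoff \<alpha> g Z \<tau> \<omega> =
    (case \<tau> \<omega> of enat n \<Rightarrow> ereal (payoff \<alpha> g Z n \<omega>)
     | \<infinity> \<Rightarrow> limsup (\<lambda>n. ereal (payoff \<alpha> g Z n \<omega>)))"

text \<open>
  Expectation of an extended real random variable, as the difference of the integrals of the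
  positive and the negative part; it exists unless both are infinite. (The library's Bochner
  integral does not cover extended real integrands or infinite values.)
\<close>

definition expectation_exists :: "'w measure \<Rightarrow> ('w \<Rightarrow> ereal) \<Rightarrow> bool" where
  "expectation_exists Q f \<longleftrightarrow>
    (\<integral>\<^sup>+\<omega>. e2ennreal (f \<omega>) \<partial>Q) < \<infinity> \<or> (\<integral>\<^sup>+\<omega>. e2ennreal (- f \<omega>) \<partial>Q) < \<infinity>"

definition ereal_expectation :: "'w measure \<Rightarrow> ('w \<Rightarrow> ereal) \<Rightarrow> ereal" where
  "ereal_expectation Q f =
    enn2ereal (\<integral>\<^sup>+\<omega>. e2ennreal (f \<omega>) \<partial>Q) - enn2ereal (\<integral>\<^sup>+\<omega>. e2ennreal (- f \<omega>) \<partial>Q)"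

text \<open>\<open>entrance Z \<sigma> B\<close> is \<open>\<tau>\<^sub>\<sigma>(B)\<close>, the first entrance time into \<open>B\<close> not before \<open>\<sigma>\<close>; in
  \<^typ>\<open>enat\<close>, the infimum of the empty set is \<open>\<infinity>\<close>.\<close>

definition entrance :: "(nat \<Rightarrow> 'w \<Rightarrow> 's) \<Rightarrow> ('w \<Rightarrow> enat) \<Rightarrow> 's set \<Rightarrow> 'w \<Rightarrow> enat" where
  "entrance Z \<sigma> B \<omega> = Inf {enat k | k. \<sigma> \<omega> \<le> enat k \<and> Z k \<omega> \<in> B}"

abbreviation entrance_from :: "(nat \<Rightarrow> 'w \<Rightarrow> 's) \<Rightarrow> nat \<Rightarrow> 's set \<Rightarrow> 'w \<Rightarrow> enat" where
  "entrance_from Z l \<equiv> entrance Z (\<lambda>_. enat l)"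

text \<open>\<open>star_set P \<alpha> g Z k B\<close> is \<open>B\<^sup>*\<^sup>k\<close>, and \<open>iter_set P \<alpha> g Z \<kappa> B k\<close> is \<open>B\<^sup>k\<close> with \<open>B\<^sup>0 = B\<close>.\<close>

definition star_set ::
  "('s \<Rightarrow> 'w measure) \<Rightarrow> ('s \<Rightarrow> real) \<Rightarrow> ('s \<Rightarrow> real) \<Rightarrow> (nat \<Rightarrow> 'w \<Rightarrow> 's) \<Rightarrow> nat \<Rightarrow> 's set \<Rightarrow> 's set" where
  "star_set P \<alpha> g Z k B =
    {z \<in> B. \<forall>l\<in>{1..k}.
      ereal (g z) \<ge> ereal_expectation (P z) (stopped_payoff \<alpha> g Z (entrance_from Z l B))}"

primrec iter_set ::
  "('s \<Rightarrow> 'w measure) \<Rightarrow> ('s \<Rightarrow> real) \<Rightarrow> ('s \<Rightarrow> real) \<Rightarrow> (nat \<Rightarrow> 'w \<Rightarrow> 's) \<Rightarrow> (nat \<Rightarrow> nat) \<Rightarrow>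
    's set \<Rightarrow> nat \<Rightarrow> 's set" where
  "iter_set P \<alpha> g Z \<kappa> B 0 = B"
| "iter_set P \<alpha> g Z \<kappa> B (Suc k) = star_set P \<alpha> g Z (\<kappa> (Suc k)) (iter_set P \<alpha> g Z \<kappa> B k)"

end

theory Submission
  imports Defs
begin

text \<open>
  From a state in \<open>B - B\<^sup>*\<^sup>k\<close> it is better to continue to some \<open>\<tau>\<^sub>l(B)\<close> with \<open>l \<le> k\<close> than to stop, and
  it does no harm to cut this continuation off at the first later visit of \<open>B\<^sup>*\<^sup>k\<close>. Iterating
  these improvements turns any \<open>\<tau> \<in> \<T>(B)\<close> into the first entrance into \<open>B\<^sup>*\<^sup>k\<close> after \<open>\<tau>\<close>, and
  continuity gives \<open>E X\<^sub>\<tau> \<le> E X\<^sub>\<sigma>\<close> for this entrance time \<open>\<sigma>\<close>. Along \<open>B\<^sup>0, B\<^sup>1, \<dots>\<close> the entrance times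
  after \<open>\<tau>\<close> increase to the one of \<open>F\<close>, so rules in \<open>\<T>(F)\<close> suffice. On \<open>F\<close>, continuity yields
  \<open>g(z) \<ge> E(X\<^sub>\<sigma> | Z\<^sub>0 = z)\<close> for \<open>\<sigma> = \<tau>\<^sub>1(F)\<close>; hence truncating \<open>\<tau> \<in> \<T>(F)\<close> at the successive visits of
  \<open>F\<close> gives a sequence of expectations that decreases from the one of \<open>\<tau>\<^sub>0(F)\<close> to the one of \<open>\<tau>\<close>.
\<close>

subsection \<open>Path space and path functionals\<close>

definition cylinder :: "'s list \<Rightarrow> (nat \<Rightarrow> 's) set" where
  "cylinder xs = {f. \<forall>i<length xs. f i = xs ! i}"

text \<open>The empty set joins the generator because incompatible cylinders have empty
  intersection; with it the generator is stable under intersections.\<close>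

definition path_space :: "(nat \<Rightarrow> 's) measure" where
  "path_space = sigma UNIV (insert {} (range cylinder))"

lemma sets_path_space: "sets path_space = sigma_sets UNIV (insert {} (range cylinder))"
  and space_path_space [simp]: "space path_space = UNIV"
  by (simp_all add: path_space_def sets_measure_of_conv space_measure_of_conv)

lemma cylinder_Nil [simp]: "cylinder [] = UNIV"
  by (simp add: cylinder_def)

text \<open>Two cylinders are either disjoint or nested: a path lying in both shows that the shorter
  list is a prefix of the longer one.\<close>

lemma Int_stable_cylinder: "Int_stable (insert {} (range cylinder))"
proof -
  have *: "cylinder xs \<inter> cylinder ys \<in> insert {} {cylinder ys}" if "length xs \<le> length ys"
    for xs ys :: "'s list"
  proof (cases "cylinder xs \<inter> cylinder ys = {}")
    case False
    then obtain f where "f \<in> cylinder xs" "f \<in> cylinder ys" by auto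
    with that have "xs ! i = ys ! i" if "i < length xs" for i
      using that by (auto simp: cylinder_def)
    with \<open>length xs \<le> length ys\<close> have "cylinder ys \<subseteq> cylinder xs"
      by (auto simp: cylinder_def)
    then show ?thesis by auto
  qed simp
  have "cylinder xs \<inter> cylinder ys \<in> insert {} (range cylinder)" for xs ys :: "'s list"
    using *[of xs ys] *[of ys xs] by (cases "length xs \<le> length ys") (auto simp: Int_commute)
  then show ?thesis unfolding Int_stable_def by auto
qed

lemma measurable_path:
  fixes X :: "nat \<Rightarrow> 'w \<Rightarrow> 's::countable"
  assumes "\<And>i. X i \<in> measurable M (count_space UNIV)"
  shows "(\<lambda>\<omega> i. X i \<omega>) \<in> measurable M path_space"
  unfolding path_space_def
proof (rule measurable_measure_of)
  fix C :: "(nat \<Rightarrow> 's) set" assume "C \<in> insert {} (range cylinder)"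
  then show "(\<lambda>\<omega> i. X i \<omega>) -` C \<inter> space M \<in> sets M"
  proof
    assume "C \<in> range cylinder"
    then obtain xs where C: "C = cylinder xs" by auto
    have "{\<omega> \<in> space M. \<forall>i<length xs. X i \<omega> = xs ! i} \<in> sets M"
      using assms by measurable
    also have "{\<omega> \<in> space M. \<forall>i<length xs. X i \<omega> = xs ! i} = (\<lambda>\<omega> i. X i \<omega>) -` C \<inter> space M"
      by (auto simp: C cylinder_def)
    finally show ?thesis .
  qed simp
qed auto

text \<open>There are only countably many lists over a countable state space, so a coordinate event
  is a countable union of cylinders.\<close>

lemma measurable_coordinate [measurable]:
  "(\<lambda>f::nat \<Rightarrow> 's::countable. f i) \<in> measurable path_space (count_space UNIV)"
proof -
  have "{f. f i = x} \<in> sets path_space" for x :: 's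
  proof -
    have "{f. f i = x} = (\<Union>xs\<in>{xs. length xs = Suc i \<and> xs ! i = x}. cylinder xs)"
    proof safe
      fix f :: "nat \<Rightarrow> 's"
      have "f \<in> cylinder (map f [0..<Suc i])"
        by (auto simp: cylinder_def nth_append less_Suc_eq)
      moreover have "map f [0..<Suc i] ! i = f i" by (simp add: nth_append)
      ultimately show "f \<in> (\<Union>xs\<in>{xs. length xs = Suc i \<and> xs ! i = f i}. cylinder xs)"
        by (intro UN_I) auto
    qed (auto simp: cylinder_def)
    also have "\<dots> \<in> sets path_space"
      by (intro sets.countable_UN'' ) (auto simp: sets_path_space intro: sigma_sets.Basic)
    finally show ?thesis .
  qed
  then show ?thesis
    by (subst measurable_count_space_eq2_countable) (auto simp: vimage_def)
qed

lemma measurable_map_list: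
  fixes X :: "nat \<Rightarrow> 'w \<Rightarrow> 's::countable"
  assumes "\<And>i. i \<in> set is \<Longrightarrow> X i \<in> measurable M (count_space UNIV)"
  shows "(\<lambda>\<omega>. map (\<lambda>i. X i \<omega>) is) \<in> measurable M (count_space UNIV)"
  using assms
proof (induction "is")
  case (Cons a "is")
  have L: "(\<lambda>\<omega>. map (\<lambda>i. X i \<omega>) is) \<in> measurable M (count_space UNIV)"
    by (rule Cons.IH) (auto intro: Cons.prems)
  have X: "X a \<in> measurable M (count_space UNIV)" by (rule Cons.prems) simp
  have "(\<lambda>\<omega>. x # map (\<lambda>i. X i \<omega>) is) \<in> measurable M (count_space UNIV)" for x
    by (rule measurable_compose[OF L]) simp
  from measurable_compose_countable[OF this X] show ?case by simp
qed simp

section \<open>Stopping rules as functionals of the path\<close>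

lemma measurable_enat_le:
  assumes [measurable]: "\<And>n. Measurable.pred M (\<lambda>\<omega>. \<tau> \<omega> \<le> enat n)"
  shows "\<tau> \<in> measurable M (count_space UNIV)"
proof -
  have "Measurable.pred M (\<lambda>\<omega>. \<tau> \<omega> = x)" for x
  proof (cases x)
    case (enat n)
    have "\<tau> \<omega> = x \<longleftrightarrow> \<tau> \<omega> \<le> enat n \<and> (\<forall>m<n. \<not> \<tau> \<omega> \<le> enat m)" for \<omega>
      unfolding enat by (cases "\<tau> \<omega>") (auto, meson le_neq_implies_less order_refl)
    then show ?thesis by simp
  next
    case infinity
    have "\<tau> \<omega> = x \<longleftrightarrow> (\<forall>n. \<not> \<tau> \<omega> \<le> enat n)" for \<omega>
      unfolding infinity by (cases "\<tau> \<omega>") auto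
    then show ?thesis by simp
  qed
  then show ?thesis
    by (subst measurable_count_space_eq2_countable) (auto simp: pred_def vimage_def Int_def conj_commute)
qed

text \<open>The state space being countable, these are the stopping times of the natural filtration of
  the coordinate process.\<close>

definition path_rule :: "((nat \<Rightarrow> 's) \<Rightarrow> enat) \<Rightarrow> bool" where
  "path_rule r \<longleftrightarrow> (\<forall>n f f'. (\<forall>i\<le>n. f i = f' i) \<longrightarrow> r f \<le> enat n \<longrightarrow> r f' \<le> enat n)"

lemma path_rule_cong: "path_rule r \<Longrightarrow> (\<And>i. i \<le> n \<Longrightarrow> f i = f' i) \<Longrightarrow> r f \<le> enat n \<longleftrightarrow> r f' \<le> enat n"
  unfolding path_rule_def by metis

text \<open>Whether a path rule has stopped by time \<open>n\<close> is decided by the list of the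
  first \<open>Suc n\<close> states. Such lists form a countable type, so every function of this
  list is measurable.\<close>

lemma pred_path_rule:
  fixes X :: "nat \<Rightarrow> 'w \<Rightarrow> 's::countable"
  assumes r: "path_rule r" and X: "\<And>i. i \<le> n \<Longrightarrow> X i \<in> measurable M (count_space UNIV)"
  shows "Measurable.pred M (\<lambda>\<omega>. r (\<lambda>i. X i \<omega>) \<le> enat n)"
proof -
  \<comment> \<open>Beyond index \<open>n\<close> the list lookup is unspecified, but those states
    do not affect stopping by time \<open>n\<close>.\<close>
  have "r (\<lambda>i. X i \<omega>) \<le> enat n \<longleftrightarrow> r (\<lambda>i. map (\<lambda>i. X i \<omega>) [0..<Suc n] ! i) \<le> enat n" for \<omega>
    by (rule path_rule_cong[OF r]) (auto simp: nth_append)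
  moreover have "(\<lambda>\<omega>. map (\<lambda>i. X i \<omega>) [0..<Suc n]) \<in> measurable M (count_space UNIV)"
    by (rule measurable_map_list) (auto intro: X)
  then have "Measurable.pred M (\<lambda>\<omega>. r (\<lambda>i. map (\<lambda>i. X i \<omega>) [0..<Suc n] ! i) \<le> enat n)"
    by (rule measurable_compose) simp
  ultimately show ?thesis by simp
qed

lemma measurable_path_rule:
  fixes r :: "(nat \<Rightarrow> 's::countable) \<Rightarrow> enat"
  assumes "path_rule r"
  shows "r \<in> measurable path_space (count_space UNIV)"
  by (rule measurable_enat_le) (use pred_path_rule[OF assms, of _ "\<lambda>i f. f i"] in simp)

lemma measurable_stopped_payoff:
  assumes Z: "\<And>n. Z n \<in> measurable M (count_space UNIV)"
    and \<tau>: "\<tau> \<in> measurable M (count_space UNIV)"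
  shows "stopped_payoff \<alpha> g Z \<tau> \<in> borel_measurable M"
proof -
  have h [measurable]: "(\<lambda>\<omega>. h (Z n \<omega>)) \<in> borel_measurable M" for h :: "_ \<Rightarrow> real" and n
    by (rule measurable_compose[OF Z]) simp
  have [measurable]: "payoff \<alpha> g Z n \<in> borel_measurable M" for n
    unfolding payoff_def by measurable
  have "(\<lambda>\<omega>. case t of enat n \<Rightarrow> ereal (payoff \<alpha> g Z n \<omega>)
     | \<infinity> \<Rightarrow> limsup (\<lambda>n. ereal (payoff \<alpha> g Z n \<omega>))) \<in> borel_measurable M" for t
    by (cases t) auto
  from measurable_compose_countable[OF this \<tau>] show ?thesis
    unfolding stopped_payoff_def[abs_def] .
qed

text \<open>Moving the negative parts to the other side makes the comparison of expectations additive,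
  so that it can be checked on the pieces of a countable partition.\<close>

lemma enn2ereal_diff_le_iff:
  assumes "a < \<infinity> \<or> b < \<infinity>" "a' < \<infinity> \<or> b' < \<infinity>"
  shows "enn2ereal a - enn2ereal b \<le> enn2ereal a' - enn2ereal b' \<longleftrightarrow> a + b' \<le> a' + b"
  using assms
  by (cases a; cases b; cases a'; cases b')
    (auto simp: top_unique ennreal_plus[symmetric] simp del: ennreal_plus)

lemma ereal_expectation_le_iff:
  assumes "expectation_exists Q f" "expectation_exists Q' f'"
  shows "ereal_expectation Q f \<le> ereal_expectation Q' f' \<longleftrightarrow>
    (\<integral>\<^sup>+\<omega>. e2ennreal (f \<omega>) \<partial>Q) + (\<integral>\<^sup>+\<omega>. e2ennreal (- f' \<omega>) \<partial>Q')
      \<le> (\<integral>\<^sup>+\<omega>. e2ennreal (f' \<omega>) \<partial>Q') + (\<integral>\<^sup>+\<omega>. e2ennreal (- f \<omega>) \<partial>Q)"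
  using assms unfolding expectation_exists_def ereal_expectation_def
  by (intro enn2ereal_diff_le_iff) auto

lemma e2ennreal_mult:
  assumes "0 \<le> c"
  shows "e2ennreal (ereal c * x) = ennreal c * e2ennreal x"
proof (cases x)
  case (real r)
  then show ?thesis
    using assms by (cases "0 \<le> r") (auto simp: ennreal_mult mult_nonneg_nonpos ennreal_neg)
next
  case PInf
  then show ?thesis using assms by (cases "c = 0") (auto simp: ennreal_mult_top)
next
  case MInf
  then show ?thesis using assms by (cases "c = 0") (auto simp: e2ennreal_neg)
qed

section \<open>Pay-offs under a time shift\<close>

lemma payoff_shift:
  "payoff \<alpha> g Z (n + m) \<omega> = (\<Prod>i<n. \<alpha> (Z i \<omega>)) * payoff \<alpha> g (\<lambda>i f. f i) m (\<lambda>i. Z (n + i) \<omega>)"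
proof -
  have "(\<Prod>i<n + m. \<alpha> (Z i \<omega>)) = (\<Prod>i<n. \<alpha> (Z i \<omega>)) * (\<Prod>i<m. \<alpha> (Z (n + i) \<omega>))"
    by (induction m) (auto simp: mult_ac)
  then show ?thesis by (simp add: payoff_def)
qed

text \<open>A limes superior ignores the first \<open>n\<close> terms, and a nonnegative finite
  factor can be pulled out of it. So the discount collected up to \<open>n\<close> factors out even
  if the rule never stops.\<close>

lemma stopped_payoff_shift:
  assumes "\<And>z. 0 \<le> \<alpha> z" and "\<rho> \<omega> = enat n + r (\<lambda>i. Z (n + i) \<omega>)"
  shows "stopped_payoff \<alpha> g Z \<rho> \<omega> =
    ereal (\<Prod>i<n. \<alpha> (Z i \<omega>)) * stopped_payoff \<alpha> g (\<lambda>i f. f i) r (\<lambda>i. Z (n + i) \<omega>)"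
proof (cases "r (\<lambda>i. Z (n + i) \<omega>)")
  case (enat m)
  then show ?thesis by (simp add: stopped_payoff_def assms(2) payoff_shift)
next
  case infinity
  have "limsup (\<lambda>k. ereal (payoff \<alpha> g Z k \<omega>)) = limsup (\<lambda>k. ereal (payoff \<alpha> g Z (n + k) \<omega>))"
    using limsup_shift_k[of "\<lambda>k. ereal (payoff \<alpha> g Z k \<omega>)" n] by (simp add: add.commute)
  also have "\<dots> = ereal (\<Prod>i<n. \<alpha> (Z i \<omega>)) *
      limsup (\<lambda>k. ereal (payoff \<alpha> g (\<lambda>i f. f i) k (\<lambda>i. Z (n + i) \<omega>)))"
    by (subst limsup_ereal_mult_left[symmetric]) (auto simp: payoff_shift assms(1) prod_nonneg)
  finally show ?thesis using infinity by (simp add: stopped_payoff_def assms(2))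
qed

subsection \<open>The Markov property\<close>

context markov_chain
begin

lemma sets_filtration: "sets (\<A> n) \<subseteq> sets M"
  using subalgebra_filtration by (simp add: subalgebra_def)

lemma space_law [simp]: "space (P z) = space M"
  by (rule sets_eq_imp_space_eq) (rule sets_law)

lemma Z_filtration: "m \<le> n \<Longrightarrow> Z m \<in> measurable (\<A> n) (count_space UNIV)"
  using adapted[of m] sets_F_mono[of m n] by (auto simp: measurable_def space_F)

lemma Z_measurable: "Z n \<in> measurable M (count_space UNIV)"
  using adapted[of n] sets_filtration[of n] by (auto simp: measurable_def space_F)

lemma law_measurable: "measurable (P z) N = measurable M N"
  by (rule measurable_cong_sets) (auto simp: sets_law)

text \<open>Integrating the conditional transition probability over \<open>A\<close> turns the
  almost sure Markov property into an identity of measures: on \<open>A\<close> the integrand is the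
  constant \<open>pmf (K y) x\<close>.\<close>

lemma emeasure_step:
  assumes A: "A \<in> sets (\<A> n)" "A \<subseteq> {\<omega>. Z n \<omega> = y}"
  shows "emeasure (P z) (A \<inter> {\<omega>\<in>space M. Z (Suc n) \<omega> = x}) = emeasure (P z) A * pmf (K y) x"
proof -
  interpret prob_space "P z" by (rule prob_space_law)
  interpret finite_measure_subalgebra "P z" "\<A> n"
    using subalgebra_filtration by unfold_locales (auto simp: subalgebra_def sets_law)
  have Z [measurable]: "Z (Suc n) \<in> measurable (P z) (count_space UNIV)"
    using Z_measurable by (simp add: law_measurable)
  have A' [measurable]: "A \<in> sets (P z)" using A sets_filtration by (auto simp: sets_law)
  let ?f = "\<lambda>\<omega>. indicator {x} (Z (Suc n) \<omega>) :: real"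
  let ?B = "A \<inter> {\<omega>\<in>space M. Z (Suc n) \<omega> = x}"
  have B: "{\<omega>\<in>space (P z). Z (Suc n) \<omega> = x} \<in> sets (P z)" by measurable
  have int: "integrable (P z) ?f"
    by (rule integrable_const_bound[where B=1]) (auto simp: indicator_def)
  have "(\<integral>\<omega>\<in>A. ?f \<omega> \<partial>P z) = (\<integral>\<omega>\<in>A. real_cond_exp (P z) (\<A> n) ?f \<omega> \<partial>P z)"
    by (rule real_cond_exp_intA[OF int A(1)])
  also have "\<dots> = (\<integral>\<omega>. indicator A \<omega> * pmf (K y) x \<partial>P z)"
    unfolding set_lebesgue_integral_def
  proof (rule integral_cong_AE)
    show "AE \<omega> in P z. indicator A \<omega> *\<^sub>R real_cond_exp (P z) (\<A> n) ?f \<omega> = indicator A \<omega> * pmf (K y) x"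
      using markov[of z n x] by eventually_elim (use A in \<open>auto simp: indicator_def\<close>)
  qed auto
  also have "\<dots> = measure (P z) A * pmf (K y) x" using sets.sets_into_space[OF A'] by (simp add: Int_absorb2)
  also have "(\<integral>\<omega>\<in>A. ?f \<omega> \<partial>P z) = (\<integral>\<omega>. indicator ?B \<omega> \<partial>P z)"
    unfolding set_lebesgue_integral_def
    by (rule Bochner_Integration.integral_cong) (auto simp: indicator_def)
  also have "\<dots> = measure (P z) ?B"
    using B A' by simp (rule arg_cong[where f="measure (P z)"], auto)
  finally show ?thesis by (simp add: emeasure_eq_measure ennreal_mult)
qed

text \<open>These weights depend neither on the time nor on the starting state of the law, which is
  what makes shifted paths under \<open>P z\<close> comparable with paths under
  \<open>P y\<close>.\<close>

primrec path_weight :: "'s \<Rightarrow> 's list \<Rightarrow> ennreal" where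
  "path_weight y [] = 1"
| "path_weight y (x # xs) = ennreal (pmf (K y) x) * path_weight x xs"

text \<open>After one step the event is in \<open>\<A> (Suc n)\<close> and fixes the state at time
  \<open>Suc n\<close>, so \<open>emeasure_step\<close> can be repeated with it in place of
  \<open>A\<close>. The list begins at time \<open>Suc n\<close> because \<open>A\<close> fixes the
  present state already.\<close>

lemma emeasure_future:
  assumes "A \<in> sets (\<A> n)" "A \<subseteq> {\<omega>. Z n \<omega> = y}"
  shows "emeasure (P z) (A \<inter> {\<omega>\<in>space M. \<forall>i<length xs. Z (Suc (n + i)) \<omega> = xs ! i}) =
    emeasure (P z) A * path_weight y xs"
  using assms
proof (induction xs arbitrary: n y A)
  case Nil
  then have "A \<subseteq> space M" using sets.sets_into_space[of A "\<A> n"] by (simp add: space_F)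
  then show ?case by (simp add: Int_absorb2)
next
  case (Cons x xs)
  let ?A = "A \<inter> {\<omega>\<in>space M. Z (Suc n) \<omega> = x}"
  have A: "?A \<in> sets (\<A> (Suc n))"
  proof (rule sets.Int)
    show "A \<in> sets (\<A> (Suc n))" using Cons.prems(1) sets_F_mono[of n "Suc n"] by auto
    have [measurable]: "Z (Suc n) \<in> measurable (\<A> (Suc n)) (count_space UNIV)" by (rule adapted)
    have "{\<omega>\<in>space (\<A> (Suc n)). Z (Suc n) \<omega> = x} \<in> sets (\<A> (Suc n))" by measurable
    then show "{\<omega>\<in>space M. Z (Suc n) \<omega> = x} \<in> sets (\<A> (Suc n))" by (simp add: space_F)
  qed
  have "A \<inter> {\<omega>\<in>space M. \<forall>i<length (x # xs). Z (Suc (n + i)) \<omega> = (x # xs) ! i} =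
      ?A \<inter> {\<omega>\<in>space M. \<forall>i<length xs. Z (Suc (Suc n + i)) \<omega> = xs ! i}"
    by (auto simp: less_Suc_eq_0_disj)
  moreover have "?A \<subseteq> {\<omega>. Z (Suc n) \<omega> = x}" by auto
  note Cons.IH[OF A this]
  ultimately show ?case using emeasure_step[OF Cons.prems]
    by (simp add: mult.assoc)
qed

text \<open>Functionals on path space take the place of shift operators, which need not exist on \<open>M\<close>.\<close>

lemma nn_integral_future:
  assumes A: "A \<in> sets (\<A> n)" "A \<subseteq> {\<omega>. Z n \<omega> = y}"
    and \<Phi>: "\<Phi> \<in> borel_measurable path_space"
  shows "(\<integral>\<^sup>+\<omega>. \<Phi> (\<lambda>i. Z (n + i) \<omega>) * indicator A \<omega> \<partial>P z) =
    emeasure (P z) A * (\<integral>\<^sup>+\<omega>. \<Phi> (\<lambda>i. Z i \<omega>) \<partial>P y)"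
proof -
  interpret z: prob_space "P z" by (rule prob_space_law)
  interpret y: prob_space "P y" by (rule prob_space_law)
  have A' [measurable]: "A \<in> sets (P z)" using A sets_filtration by (auto simp: sets_law)
  have S [measurable]: "(\<lambda>\<omega> i. Z (m + i) \<omega>) \<in> measurable (P x) path_space" for x m
    unfolding law_measurable by (rule measurable_path) (rule Z_measurable)
  have S0 [measurable]: "(\<lambda>\<omega> i. Z i \<omega>) \<in> measurable (P x) path_space" for x
    using S[of 0] by simp
  \<comment> \<open>Both sides are integrals of \<open>\<Phi>\<close> against measures on path
    space: the law of the shifted path on \<open>A\<close>, and the law of the path from
    \<open>y\<close> scaled by the mass of \<open>A\<close>. It suffices to compare them on
    cylinders.\<close>
  let ?L = "distr (density (P z) (indicator A)) path_space (\<lambda>\<omega> i. Z (n + i) \<omega>)"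
  let ?R = "scale_measure (emeasure (P z) A) (distr (P y) path_space (\<lambda>\<omega> i. Z i \<omega>))"
  have S' [measurable]: "(\<lambda>\<omega> i. Z (n + i) \<omega>) \<in> measurable (density (P z) (indicator A)) path_space"
    using S by simp
  have cyl [measurable]: "cylinder xs \<in> sets path_space" for xs :: "'s list"
    by (auto simp: sets_path_space intro: sigma_sets.Basic)
  have L: "emeasure ?L C = emeasure (P z) (A \<inter> {\<omega>\<in>space M. (\<lambda>i. Z (n + i) \<omega>) \<in> C})"
    if [measurable]: "C \<in> sets path_space" for C
  proof -
    have "(\<lambda>\<omega> i. Z (n + i) \<omega>) -` C \<inter> space M \<in> sets (P z)"
      using measurable_sets[OF S that] by simp
    then have "emeasure ?L C = (\<integral>\<^sup>+\<omega>. indicator A \<omega> * indicator ((\<lambda>\<omega> i. Z (n + i) \<omega>) -` C \<inter> space M) \<omega> \<partial>P z)"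
      by (subst emeasure_distr) (auto simp: emeasure_density)
    also have "\<dots> = (\<integral>\<^sup>+\<omega>. indicator (A \<inter> ((\<lambda>\<omega> i. Z (n + i) \<omega>) -` C \<inter> space M)) \<omega> \<partial>P z)"
      by (simp add: indicator_inter_arith)
    also have "\<dots> = emeasure (P z) (A \<inter> ((\<lambda>\<omega> i. Z (n + i) \<omega>) -` C \<inter> space M))"
      by (rule nn_integral_indicator) (rule sets.Int[OF A' \<open>_ -` C \<inter> space M \<in> _\<close>])
    also have "(\<lambda>\<omega> i. Z (n + i) \<omega>) -` C \<inter> space M = {\<omega>\<in>space M. (\<lambda>i. Z (n + i) \<omega>) \<in> C}" by auto
    finally show ?thesis .
  qed
  have R: "emeasure ?R C = emeasure (P z) A * emeasure (P y) {\<omega>\<in>space M. (\<lambda>i. Z i \<omega>) \<in> C}"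
    if "C \<in> sets path_space" for C
    using that by (simp add: emeasure_distr vimage_def Int_def conj_commute)
  have "?L = ?R"
  proof (rule measure_eqI_generator_eq[where E="insert {} (range cylinder)" and \<Omega>=UNIV
        and A="\<lambda>_. UNIV"])
    fix C :: "(nat \<Rightarrow> 's) set" assume "C \<in> insert {} (range cylinder)"
    \<comment> \<open>The empty list only compares total masses. The head of a nonempty list is the
      present state, which is \<open>y\<close> on \<open>A\<close>; \<open>emeasure_future\<close>
      handles the tail.\<close>
    then consider "C = {}" | "C = UNIV" | x xs where "C = cylinder (x # xs)"
      by (metis cylinder_Nil imageE insertE neq_Nil_conv)
    then show "emeasure ?L C = emeasure ?R C"
    proof cases
      case 2
      have "A \<subseteq> space M" using sets.sets_into_space[OF A'] by simp
      then have "emeasure ?L C = emeasure (P z) A" using sets.top[of path_space] by (subst L) (auto simp: 2 Int_absorb2)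
      moreover have "emeasure ?R C = emeasure (P z) A"
        using sets.top[of path_space] y.emeasure_space_1 by (subst R) (auto simp: 2)
      ultimately show ?thesis by simp
    next
      case (3 x xs)
      have eq: "{\<omega>\<in>space M. (\<lambda>i. Z (m + i) \<omega>) \<in> C} = {\<omega>\<in>space M. Z m \<omega> = x} \<inter>
          {\<omega>\<in>space M. \<forall>i<length xs. Z (Suc (m + i)) \<omega> = xs ! i}" for m
        by (auto simp: 3 cylinder_def less_Suc_eq_0_disj)
      have l: "emeasure ?L C = (if x = y then emeasure (P z) A * path_weight y xs else 0)"
      proof -
        have "A \<inter> {\<omega>\<in>space M. Z n \<omega> = x} = (if x = y then A else {})"
          using A(2) sets.sets_into_space[OF A'] by auto
        then show ?thesis
          using emeasure_future[OF A, of z xs]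
          by (subst L) (auto simp: 3 eq[unfolded 3] Int_assoc[symmetric] )
      qed
      \<comment> \<open>Under \<open>P y\<close> the chain starts in \<open>y\<close> only almost
        surely, so \<open>emeasure_future\<close> is applied to the event \<open>?Y\<close> of full
        measure.\<close>
      let ?Y = "{\<omega>\<in>space M. Z 0 \<omega> = y}"
      have Y: "?Y \<in> sets (\<A> 0)"
        using measurable_sets[OF adapted[of 0], of "{y}"] by (simp add: space_F vimage_def Int_def conj_commute)
      have ZY: "emeasure (P y) ?Y = 1"
        using start[of y] Y sets_filtration[of 0] y.emeasure_space_1
        by (subst emeasure_eq_AE[where B="space M"]) (auto simp: sets_law)
      have "emeasure (P y) {\<omega>\<in>space M. (\<lambda>i. Z i \<omega>) \<in> C} = (if x = y then path_weight y xs else 0)"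
      proof (cases "x = y")
        case True
        have "{\<omega>\<in>space M. (\<lambda>i. Z i \<omega>) \<in> C} = ?Y \<inter> {\<omega>\<in>space M. \<forall>i<length xs. Z (Suc (0 + i)) \<omega> = xs ! i}"
          using eq[of 0] True by simp
        moreover have "?Y \<subseteq> {\<omega>. Z 0 \<omega> = y}" by auto
        ultimately show ?thesis
          using emeasure_future[OF Y, of y y xs] ZY True by simp
      next
        case False
        have "AE \<omega> in P y. \<not> (\<lambda>i. Z i \<omega>) \<in> C"
          using start[of y] by eventually_elim (use False in \<open>auto simp: 3 cylinder_def\<close>)
        from emeasure_eq_0_AE[OF this] False show ?thesis by simp
      qed
      with l show ?thesis by (subst R) (auto simp: 3)
    qed simp
  next
    show "emeasure ?L UNIV \<noteq> \<infinity>"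
      using sets.top[of path_space] by (subst L) auto
  next
    have "UNIV = cylinder []" by simp
    then show "range (\<lambda>_. UNIV) \<subseteq> insert {} (range cylinder)" by blast
  qed (auto simp: Int_stable_cylinder sets_path_space)
  then have "(\<integral>\<^sup>+f. \<Phi> f \<partial>?L) = (\<integral>\<^sup>+f. \<Phi> f \<partial>?R)" by simp
  moreover have "(\<integral>\<^sup>+f. \<Phi> f \<partial>?L) = (\<integral>\<^sup>+\<omega>. \<Phi> (\<lambda>i. Z (n + i) \<omega>) * indicator A \<omega> \<partial>P z)"
    using \<Phi> by (simp add: nn_integral_distr nn_integral_density mult.commute)
  moreover have "(\<integral>\<^sup>+f. \<Phi> f \<partial>?R) = emeasure (P z) A * (\<integral>\<^sup>+\<omega>. \<Phi> (\<lambda>i. Z i \<omega>) \<partial>P y)"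
    using \<Phi> by (simp add: nn_integral_distr nn_integral_scale_measure)
  ultimately show ?thesis by simp
qed

end

subsection \<open>Entrance times and stopping rules\<close>

lemma enat_eqI: "(\<And>n. x \<le> enat n \<longleftrightarrow> y \<le> enat n) \<Longrightarrow> x = y"
  by (cases x; cases y) (auto intro: antisym)

lemma enat_le_iff: "x \<le> y \<longleftrightarrow> (\<forall>n. y \<le> enat n \<longrightarrow> x \<le> enat n)"
  by (cases x; cases y) auto

text \<open>Fits iterated rules: after \<open>n\<close> rounds they have reached the target
  \<open>w\<close> or at least time \<open>n\<close>, and \<open>min (enat n) w\<close> tends to
  \<open>w\<close> for finite and infinite \<open>w\<close> alike.\<close>

lemma enat_tendsto_sandwich:
  fixes w :: enat
  assumes "\<And>n. min (enat n) w \<le> x n" "\<And>n. x n \<le> w"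
  shows "x \<longlonglongrightarrow> w"
proof (rule order_tendstoI)
  fix a assume "a < w"
  then obtain m where m: "a = enat m" by (cases a) auto
  have "a < x n" if "n > m" for n
  proof -
    have "a < min (enat n) w" using \<open>a < w\<close> that m by simp
    then show ?thesis using assms(1) by (rule less_le_trans)
  qed
  then show "\<forall>\<^sub>F n in sequentially. a < x n"
    by (rule eventually_mono[OF eventually_gt_at_top])
next
  fix a assume "w < a"
  then show "\<forall>\<^sub>F n in sequentially. x n < a"
    using assms(2) by (auto intro: always_eventually le_less_trans)
qed

lemma entrance_le_iff: "entrance Z \<sigma> B \<omega> \<le> enat n \<longleftrightarrow> (\<exists>k\<le>n. \<sigma> \<omega> \<le> enat k \<and> Z k \<omega> \<in> B)"
proof -
  \<comment> \<open>For a strict bound the infimum unfolds to an existence statement, even if the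
    set is empty.\<close>
  have "entrance Z \<sigma> B \<omega> \<le> enat n \<longleftrightarrow> entrance Z \<sigma> B \<omega> < enat (Suc n)"
    by (cases "entrance Z \<sigma> B \<omega>") auto
  also have "\<dots> \<longleftrightarrow> (\<exists>k\<le>n. \<sigma> \<omega> \<le> enat k \<and> Z k \<omega> \<in> B)"
    unfolding entrance_def Inf_less_iff by (auto simp: less_Suc_eq_le)
  finally show ?thesis .
qed

lemma entrance_enatD:
  assumes "entrance Z \<sigma> B \<omega> = enat n"
  shows "\<sigma> \<omega> \<le> enat n" "Z n \<omega> \<in> B"
proof -
  obtain k where "k \<le> n" "\<sigma> \<omega> \<le> enat k" "Z k \<omega> \<in> B"
    using entrance_le_iff[of Z \<sigma> B \<omega> n] assms by auto
  moreover from this have "entrance Z \<sigma> B \<omega> \<le> enat k" by (auto simp: entrance_le_iff)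
  ultimately show "\<sigma> \<omega> \<le> enat n" "Z n \<omega> \<in> B" using assms by auto
qed

lemma entrance_ge: "\<sigma> \<omega> \<le> entrance Z \<sigma> B \<omega>"
  by (cases "entrance Z \<sigma> B \<omega>") (auto dest: entrance_enatD)

lemma entrance_le: "\<sigma> \<omega> \<le> enat k \<Longrightarrow> Z k \<omega> \<in> B \<Longrightarrow> entrance Z \<sigma> B \<omega> \<le> enat k"
  by (auto simp: entrance_le_iff)

lemma entrance_antimono: "B' \<subseteq> B \<Longrightarrow> entrance Z \<sigma> B \<omega> \<le> entrance Z \<sigma> B' \<omega>"
  unfolding enat_le_iff[of "entrance Z \<sigma> B \<omega>"] entrance_le_iff by blast

text \<open>Places an arbitrary rule of the class of \<open>B\<close> at the start of the improving
  sequence of entrance times.\<close>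

lemma entrance_self:
  assumes "\<And>n. \<sigma> \<omega> = enat n \<Longrightarrow> Z n \<omega> \<in> B"
  shows "entrance Z \<sigma> B \<omega> = \<sigma> \<omega>"
proof (cases "\<sigma> \<omega>")
  case (enat n)
  with assms have "entrance Z \<sigma> B \<omega> \<le> \<sigma> \<omega>" by (simp add: entrance_le)
  then show ?thesis by (intro antisym entrance_ge)
next
  case infinity
  then show ?thesis using entrance_ge[of \<sigma> \<omega> Z B] by simp
qed

text \<open>Waiting for \<open>B\<close> first cannot skip a visit of \<open>B'\<close>, since every
  such visit is also one of \<open>B\<close>.\<close>

lemma entrance_entrance:
  assumes "B' \<subseteq> B"
  shows "entrance Z (entrance Z \<sigma> B) B' \<omega> = entrance Z \<sigma> B' \<omega>"
proof (rule enat_eqI)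
  fix n
  have "(\<exists>i\<le>k. \<sigma> \<omega> \<le> enat i \<and> Z i \<omega> \<in> B) \<and> Z k \<omega> \<in> B' \<longleftrightarrow> \<sigma> \<omega> \<le> enat k \<and> Z k \<omega> \<in> B'" for k
    using assms by (auto intro: order_trans)
  then show "entrance Z (entrance Z \<sigma> B) B' \<omega> \<le> enat n \<longleftrightarrow> entrance Z \<sigma> B' \<omega> \<le> enat n"
    by (simp add: entrance_le_iff)
qed

text \<open>The entrance times increase. If they stay bounded by \<open>n\<close>, one of the
  finitely many times up to \<open>n\<close> serves infinitely many of the decreasing sets, and
  hence all of them.\<close>

lemma entrance_Inter:
  assumes "decseq B"
  shows "(\<lambda>k. entrance Z \<sigma> (B k) \<omega>) \<longlonglongrightarrow> entrance Z \<sigma> (\<Inter>k. B k) \<omega>"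
proof -
  have inc: "incseq (\<lambda>k. entrance Z \<sigma> (B k) \<omega>)"
    using assms by (intro incseq_SucI entrance_antimono) (auto simp: decseq_Suc_iff)
  have "(SUP k. entrance Z \<sigma> (B k) \<omega>) = entrance Z \<sigma> (\<Inter>k. B k) \<omega>"
  proof (rule antisym)
    show "(SUP k. entrance Z \<sigma> (B k) \<omega>) \<le> entrance Z \<sigma> (\<Inter>k. B k) \<omega>"
      by (intro SUP_least entrance_antimono) auto
    show "entrance Z \<sigma> (\<Inter>k. B k) \<omega> \<le> (SUP k. entrance Z \<sigma> (B k) \<omega>)"
    proof (cases "SUP k. entrance Z \<sigma> (B k) \<omega>")
      case (enat n)
      have "\<exists>i\<le>n. \<sigma> \<omega> \<le> enat i \<and> Z i \<omega> \<in> B k" for k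
        using SUP_upper[of k UNIV "\<lambda>k. entrance Z \<sigma> (B k) \<omega>"] enat
        by (auto simp: entrance_le_iff[symmetric])
      then obtain i where i: "i k \<le> n" "\<sigma> \<omega> \<le> enat (i k)" "Z (i k) \<omega> \<in> B k" for k
        by metis
      have "finite (range i)" by (rule finite_subset[of _ "{..n}"]) (use i in auto)
      then obtain m where m: "infinite {k. i k = m}"
        using pigeonhole_infinite[of "UNIV :: nat set" i] by auto
      have "Z m \<omega> \<in> B k" for k
      proof -
        obtain k' where "k' > k" "i k' = m" using m infinite_nat_iff_unbounded[of "{k. i k = m}"] by auto
        then show ?thesis using i(3)[of k'] decseqD[OF assms, of k k'] by auto
      qed
      moreover obtain k where "i k = m" using m not_finite_existsD by blast
      ultimately show ?thesis using i[of k] enat by (auto simp: entrance_le_iff)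
    qed simp
  qed
  with LIMSEQ_SUP[OF inc] show ?thesis by simp
qed

section \<open>Rules on path space and their composition\<close>

abbreviation path_entrance :: "nat \<Rightarrow> 's set \<Rightarrow> (nat \<Rightarrow> 's) \<Rightarrow> enat" where
  "path_entrance l B \<equiv> entrance_from (\<lambda>i f. f i) l B"

lemma path_entrance: "path_entrance l B (\<lambda>i. Z i \<omega>) = entrance_from Z l B \<omega>"
  by (simp add: entrance_def)

lemma enat_add_le_iff: "enat n + x \<le> enat k \<longleftrightarrow> n \<le> k \<and> x \<le> enat (k - n)"
  by (cases x) auto

lemma enat_add_min: "enat n + min x y = min (enat n + x) (enat n + y)"
  by (rule enat_eqI) (auto simp: enat_add_le_iff min_le_iff_disj)

lemma path_entrance_shift:
  "enat n + path_entrance l B (\<lambda>i. Z (n + i) \<omega>) = entrance_from Z (n + l) B \<omega>"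
proof (rule enat_eqI)
  fix k
  have "(n \<le> k \<and> (\<exists>j\<le>k - n. l \<le> j \<and> Z (n + j) \<omega> \<in> B)) \<longleftrightarrow> (\<exists>j\<le>k. n + l \<le> j \<and> Z j \<omega> \<in> B)"
  proof
    assume "n \<le> k \<and> (\<exists>j\<le>k - n. l \<le> j \<and> Z (n + j) \<omega> \<in> B)"
    then obtain j where "n \<le> k" "j \<le> k - n" "l \<le> j" "Z (n + j) \<omega> \<in> B" by auto
    then show "\<exists>j\<le>k. n + l \<le> j \<and> Z j \<omega> \<in> B" by (intro exI[of _ "n + j"]) auto
  next
    assume "\<exists>j\<le>k. n + l \<le> j \<and> Z j \<omega> \<in> B"
    then obtain j where "j \<le> k" "n + l \<le> j" "Z j \<omega> \<in> B" by auto
    then show "n \<le> k \<and> (\<exists>j\<le>k - n. l \<le> j \<and> Z (n + j) \<omega> \<in> B)"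
      by (intro conjI exI[of _ "j - n"]) auto
  qed
  then show "enat n + path_entrance l B (\<lambda>i. Z (n + i) \<omega>) \<le> enat k \<longleftrightarrow>
      entrance_from Z (n + l) B \<omega> \<le> enat k"
    by (simp add: enat_add_le_iff entrance_le_iff)
qed

lemma path_rule_entrance: "path_rule (path_entrance l B)"
  unfolding path_rule_def entrance_le_iff by force

lemma path_rule_0: "path_rule (\<lambda>_. 0)"
  by (simp add: path_rule_def zero_enat_def)

lemma path_rule_min:
  assumes "path_rule r" "path_rule r'"
  shows "path_rule (\<lambda>f. min (r f) (r' f))"
  unfolding path_rule_def min_le_iff_disj
proof (intro allI impI)
  fix n and f f' :: "nat \<Rightarrow> 'a"
  assume eq: "\<forall>i\<le>n. f i = f' i" and le: "r f \<le> enat n \<or> r' f \<le> enat n"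
  from eq le show "r f' \<le> enat n \<or> r' f' \<le> enat n"
    using path_rule_cong[OF assms(1), of n f f'] path_rule_cong[OF assms(2), of n f f'] by auto
qed

lemma path_rule_If: "path_rule r \<Longrightarrow> path_rule r' \<Longrightarrow> path_rule (\<lambda>f. if c then r f else r' f)"
  by (cases c) simp_all

text \<open>A rule may be selected by the initial state because that state is known from time 0
  on.\<close>

lemma path_rule_start:
  assumes "\<And>x. path_rule (R x)"
  shows "path_rule (\<lambda>f. R (f 0) f)"
  unfolding path_rule_def
proof (intro allI impI)
  fix n and f f' :: "nat \<Rightarrow> 'a"
  assume eq: "\<forall>i\<le>n. f i = f' i" and "R (f 0) f \<le> enat n"
  then show "R (f' 0) f' \<le> enat n"
    using path_rule_cong[OF assms, of n f f' "f 0"] by auto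
qed

definition continue ::
  "(nat \<Rightarrow> 'w \<Rightarrow> 's) \<Rightarrow> ('w \<Rightarrow> enat) \<Rightarrow> ((nat \<Rightarrow> 's) \<Rightarrow> enat) \<Rightarrow> 'w \<Rightarrow> enat" where
  "continue Z \<sigma> r \<omega> = (case \<sigma> \<omega> of enat n \<Rightarrow> enat n + r (\<lambda>i. Z (n + i) \<omega>) | \<infinity> \<Rightarrow> \<infinity>)"

lemma continue_0: "continue Z \<sigma> (\<lambda>_. 0) \<omega> = \<sigma> \<omega>"
  by (simp add: continue_def split: enat.split)

lemma continue_ge: "\<sigma> \<omega> \<le> continue Z \<sigma> r \<omega>"
  by (simp add: continue_def split: enat.split)

lemma stopping_rules_inD:
  "\<tau> \<in> stopping_rules_in M \<A> Z B \<Longrightarrow> stopping_rule \<A> \<tau>"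
  "\<tau> \<in> stopping_rules_in M \<A> Z B \<Longrightarrow> \<omega> \<in> space M \<Longrightarrow> \<tau> \<omega> = enat n \<Longrightarrow> Z n \<omega> \<in> B"
  by (auto simp: stopping_rules_in_def)

lemma star_set_subset: "star_set P \<alpha> g Z k B \<subseteq> B"
  by (auto simp: star_set_def)

text \<open>Measurability is asked for \<open>m \<le> n\<close> only, because an event about time
  \<open>m\<close> need not belong to \<open>\<A> n\<close> for larger \<open>m\<close>.\<close>

lemma pred_Ex_le:
  assumes "\<And>m. m \<le> n \<Longrightarrow> Measurable.pred M (Q m)"
  shows "Measurable.pred M (\<lambda>\<omega>. \<exists>m\<le>n::nat. Q m \<omega>)"
proof -
  have "Measurable.pred M (\<lambda>\<omega>. m \<le> n \<and> Q m \<omega>)" for m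
    using assms[of m] by (cases "m \<le> n") simp_all
  then show ?thesis
    by (rule pred_intros_countable(2)[where P="\<lambda>\<omega> m. m \<le> n \<and> Q m \<omega>"])
qed

text \<open>The integral is the sum of the integrals over the countably many fibres of
  \<open>h\<close>. Numbering the fibres by \<open>to_nat\<close> leaves an empty piece for each
  number not hit.\<close>

lemma nn_integral_partition_mono:
  fixes h :: "'w \<Rightarrow> 'c::countable" and f f' :: "'w \<Rightarrow> ennreal"
  assumes f [measurable]: "f \<in> borel_measurable M" "f' \<in> borel_measurable M"
    and h [measurable]: "h \<in> measurable M (count_space UNIV)"
    and le: "\<And>c. (\<integral>\<^sup>+\<omega>. f \<omega> * indicator {\<omega>\<in>space M. h \<omega> = c} \<omega> \<partial>M)
      \<le> (\<integral>\<^sup>+\<omega>. f' \<omega> * indicator {\<omega>\<in>space M. h \<omega> = c} \<omega> \<partial>M)"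
  shows "(\<integral>\<^sup>+\<omega>. f \<omega> \<partial>M) \<le> (\<integral>\<^sup>+\<omega>. f' \<omega> \<partial>M)"
proof -
  define D where "D k = {\<omega>\<in>space M. to_nat (h \<omega>) = k}" for k
  have D: "D k \<in> sets M" for k unfolding D_def by measurable
  have "disjoint_family D" by (auto simp: disjoint_family_on_def D_def)
  moreover have "(\<Union>k. D k) = space M" by (auto simp: D_def)
  ultimately have *: "(\<integral>\<^sup>+\<omega>. u \<omega> \<partial>M) = (\<Sum>k. \<integral>\<^sup>+\<omega>. u \<omega> * indicator (D k) \<omega> \<partial>M)"
    if [measurable]: "u \<in> borel_measurable M" for u :: "'w \<Rightarrow> ennreal"
    using nn_integral_disjoint_family[of u M D] D nn_set_integral_space[of M u] by simp
  have "(\<integral>\<^sup>+\<omega>. f \<omega> * indicator (D k) \<omega> \<partial>M) \<le> (\<integral>\<^sup>+\<omega>. f' \<omega> * indicator (D k) \<omega> \<partial>M)" for k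
  proof (cases "k \<in> range (to_nat :: 'c \<Rightarrow> nat)")
    case True
    then obtain c :: 'c where "k = to_nat c" by auto
    then have "D k = {\<omega>\<in>space M. h \<omega> = c}" by (auto simp: D_def)
    with le[of c] show ?thesis by simp
  next
    case False
    then have "D k = {}" by (auto simp: D_def)
    then show ?thesis by simp
  qed
  then have "(\<Sum>k. \<integral>\<^sup>+\<omega>. f \<omega> * indicator (D k) \<omega> \<partial>M) \<le> (\<Sum>k. \<integral>\<^sup>+\<omega>. f' \<omega> * indicator (D k) \<omega> \<partial>M)"
    by (intro suminf_le summableI)
  with *[OF f(1)] *[OF f(2)] show ?thesis by metis
qed

section \<open>Stopping rules of the filtration\<close>

context markov_chain
begin

lemma pred_filtration_mono:
  assumes "m \<le> n" "Measurable.pred (\<A> m) Q"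
  shows "Measurable.pred (\<A> n) Q"
  using assms(2) sets_F_mono[OF assms(1)] by (auto simp: measurable_def space_F)

lemma pred_filtration: "Measurable.pred (\<A> n) Q \<Longrightarrow> Measurable.pred M Q"
  using sets_filtration[of n] by (auto simp: measurable_def space_F)

lemma stopping_rule_le: "stopping_rule \<A> \<tau> \<Longrightarrow> m \<le> n \<Longrightarrow> Measurable.pred (\<A> n) (\<lambda>\<omega>. \<tau> \<omega> \<le> enat m)"
  unfolding stopping_rule_def by (blast intro: pred_filtration_mono)

lemma stopping_rule_eq:
  assumes "stopping_rule \<A> \<tau>" "m \<le> n"
  shows "Measurable.pred (\<A> n) (\<lambda>\<omega>. \<tau> \<omega> = enat m)"
proof -
  have "Measurable.pred (\<A> n) (\<lambda>\<omega>. \<tau> \<omega> \<le> enat m \<and> (\<forall>k<m. \<not> \<tau> \<omega> \<le> enat k))"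
    using stopping_rule_le[OF assms(1)] assms(2)
    by (intro pred_intros_logic(2,3) pred_intros_countable_bounded) auto
  also have "(\<lambda>\<omega>. \<tau> \<omega> \<le> enat m \<and> (\<forall>k<m. \<not> \<tau> \<omega> \<le> enat k)) = (\<lambda>\<omega>. \<tau> \<omega> = enat m)"
  proof (rule ext)
    show "(\<tau> \<omega> \<le> enat m \<and> (\<forall>k<m. \<not> \<tau> \<omega> \<le> enat k)) = (\<tau> \<omega> = enat m)" for \<omega>
      by (cases "\<tau> \<omega>") (auto, meson le_neq_implies_less order_refl)
  qed
  finally show ?thesis .
qed

lemma stopping_rule_measurable: "stopping_rule \<A> \<tau> \<Longrightarrow> \<tau> \<in> measurable M (count_space UNIV)"
  using stopping_rule_le[of \<tau>] by (intro measurable_enat_le) (rule pred_filtration, blast)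

lemma Z_in_filtration:
  assumes "m \<le> n"
  shows "Measurable.pred (\<A> n) (\<lambda>\<omega>. Z m \<omega> \<in> B)"
proof -
  note [measurable] = Z_filtration[OF assms]
  show ?thesis by measurable
qed

lemma stopping_rule_entrance:
  assumes "stopping_rule \<A> \<sigma>"
  shows "stopping_rule \<A> (entrance Z \<sigma> B)"
  unfolding stopping_rule_def entrance_le_iff
proof (rule allI, rule pred_Ex_le)
  fix n k :: nat assume "k \<le> n"
  note [measurable] = stopping_rule_le[OF assms this] Z_in_filtration[OF this]
  show "Measurable.pred (\<A> n) (\<lambda>\<omega>. \<sigma> \<omega> \<le> enat k \<and> Z k \<omega> \<in> B)" by measurable
qed

lemma entrance_in:
  "stopping_rule \<A> \<sigma> \<Longrightarrow> entrance Z \<sigma> B \<in> stopping_rules_in M \<A> Z B"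
  by (auto simp: stopping_rules_in_def stopping_rule_entrance dest: entrance_enatD)

lemma stopping_rule_const: "stopping_rule \<A> (\<lambda>_. c)"
  by (simp add: stopping_rule_def)

lemma stopping_rule_min:
  assumes "stopping_rule \<A> \<sigma>" "stopping_rule \<A> \<tau>"
  shows "stopping_rule \<A> (\<lambda>\<omega>. min (\<sigma> \<omega>) (\<tau> \<omega>))"
  unfolding stopping_rule_def min_le_iff_disj
proof
  fix n
  note [measurable] = stopping_rule_le[OF assms(1) order_refl] stopping_rule_le[OF assms(2) order_refl]
  show "Measurable.pred (\<A> n) (\<lambda>\<omega>. \<sigma> \<omega> \<le> enat n \<or> \<tau> \<omega> \<le> enat n)" by measurable
qed

lemma stopping_rule_path:
  assumes "path_rule r"
  shows "stopping_rule \<A> (\<lambda>\<omega>. r (\<lambda>i. Z i \<omega>))"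
  unfolding stopping_rule_def
proof
  fix n
  show "Measurable.pred (\<A> n) (\<lambda>\<omega>. r (\<lambda>i. Z i \<omega>) \<le> enat n)"
    by (rule pred_path_rule[where r=r and X=Z, OF assms]) (rule Z_filtration)
qed

text \<open>Singles out the paths where \<open>\<sigma>\<close> comes before \<open>\<tau>\<close>,
  which is known at time \<open>\<sigma>\<close>. The value infinity marks the remaining paths, on
  which two compared rules will agree.\<close>

lemma stopping_rule_restrict:
  assumes "stopping_rule \<A> \<sigma>" "stopping_rule \<A> \<tau>"
  shows "stopping_rule \<A> (\<lambda>\<omega>. if \<sigma> \<omega> < \<tau> \<omega> then \<sigma> \<omega> else \<infinity>)"
  unfolding stopping_rule_def
proof
  fix n
  have "Measurable.pred (\<A> n) (\<lambda>\<omega>. \<exists>m\<le>n. \<sigma> \<omega> = enat m \<and> \<not> \<tau> \<omega> \<le> enat m)"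
  proof (rule pred_Ex_le)
    fix m assume "m \<le> n"
    note [measurable] = stopping_rule_eq[OF assms(1) this] stopping_rule_le[OF assms(2) this]
    show "Measurable.pred (\<A> n) (\<lambda>\<omega>. \<sigma> \<omega> = enat m \<and> \<not> \<tau> \<omega> \<le> enat m)" by measurable
  qed
  also have "(\<lambda>\<omega>. \<exists>m\<le>n. \<sigma> \<omega> = enat m \<and> \<not> \<tau> \<omega> \<le> enat m) =
      (\<lambda>\<omega>. (if \<sigma> \<omega> < \<tau> \<omega> then \<sigma> \<omega> else \<infinity>) \<le> enat n)"
  proof (rule ext)
    show "(\<exists>m\<le>n. \<sigma> \<omega> = enat m \<and> \<not> \<tau> \<omega> \<le> enat m) =
        ((if \<sigma> \<omega> < \<tau> \<omega> then \<sigma> \<omega> else \<infinity>) \<le> enat n)" for \<omega>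
      by (cases "\<sigma> \<omega>") auto
  qed
  finally show "Measurable.pred (\<A> n) (\<lambda>\<omega>. (if \<sigma> \<omega> < \<tau> \<omega> then \<sigma> \<omega> else \<infinity>) \<le> enat n)" .
qed

text \<open>If \<open>\<sigma>\<close> equals \<open>m\<close>, stopping by time \<open>n\<close>
  leaves \<open>n - m\<close> further steps, and these involve only the states from \<open>m\<close>
  to \<open>n\<close>.\<close>

lemma stopping_rule_continue:
  assumes "stopping_rule \<A> \<sigma>" "path_rule r"
  shows "stopping_rule \<A> (continue Z \<sigma> r)"
  unfolding stopping_rule_def
proof
  fix n
  have "Measurable.pred (\<A> n) (\<lambda>\<omega>. \<exists>m\<le>n. \<sigma> \<omega> = enat m \<and> r (\<lambda>i. Z (m + i) \<omega>) \<le> enat (n - m))"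
  proof (rule pred_Ex_le)
    fix m assume m: "m \<le> n"
    have "Measurable.pred (\<A> n) (\<lambda>\<omega>. \<sigma> \<omega> = enat m)" by (rule stopping_rule_eq[OF assms(1) m])
    moreover have "Measurable.pred (\<A> n) (\<lambda>\<omega>. r (\<lambda>i. Z (m + i) \<omega>) \<le> enat (n - m))"
      using m by (intro pred_path_rule[where r=r and X="\<lambda>i. Z (m + i)", OF assms(2)] Z_filtration) simp
    ultimately show "Measurable.pred (\<A> n) (\<lambda>\<omega>. \<sigma> \<omega> = enat m \<and> r (\<lambda>i. Z (m + i) \<omega>) \<le> enat (n - m))"
      by (rule pred_intros_logic(3))
  qed
  also have "(\<lambda>\<omega>. \<exists>m\<le>n. \<sigma> \<omega> = enat m \<and> r (\<lambda>i. Z (m + i) \<omega>) \<le> enat (n - m)) =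
      (\<lambda>\<omega>. continue Z \<sigma> r \<omega> \<le> enat n)"
  proof (rule ext)
    show "(\<exists>m\<le>n. \<sigma> \<omega> = enat m \<and> r (\<lambda>i. Z (m + i) \<omega>) \<le> enat (n - m)) =
        (continue Z \<sigma> r \<omega> \<le> enat n)" for \<omega>
      by (cases "\<sigma> \<omega>") (simp_all add: continue_def enat_add_le_iff)
  qed
  finally show "Measurable.pred (\<A> n) (\<lambda>\<omega>. continue Z \<sigma> r \<omega> \<le> enat n)" .
qed

lemma stopped_payoff_measurable:
  "stopping_rule \<A> \<tau> \<Longrightarrow> stopped_payoff \<alpha> g Z \<tau> \<in> borel_measurable (P z)"
  unfolding law_measurable
  by (intro measurable_stopped_payoff Z_measurable stopping_rule_measurable)

end

subsection \<open>Comparison of expected pay-offs\<close>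

context markov_chain
begin

text \<open>Computes the mixed sum that occurs in \<open>ereal_expectation_le_iff\<close>. The
  nonnegative factor \<open>a\<close> passes through positive and negative parts and leaves a
  functional of the future alone.\<close>

lemma nn_integral_future_pos_neg:
  fixes U U' :: "'w \<Rightarrow> ereal" and \<Phi> \<Phi>' :: "(nat \<Rightarrow> 's) \<Rightarrow> ereal"
  assumes D: "D \<in> sets (\<A> n)" "D \<subseteq> {\<omega>. Z n \<omega> = y}" and a: "0 \<le> a"
    and \<Phi> [measurable]: "\<Phi> \<in> borel_measurable path_space" "\<Phi>' \<in> borel_measurable path_space"
    and U: "\<And>\<omega>. \<omega> \<in> D \<Longrightarrow> U \<omega> = ereal a * \<Phi> (\<lambda>i. Z (n + i) \<omega>)"
      "\<And>\<omega>. \<omega> \<in> D \<Longrightarrow> U' \<omega> = ereal a * \<Phi>' (\<lambda>i. Z (n + i) \<omega>)"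
  shows "(\<integral>\<^sup>+\<omega>. (e2ennreal (U \<omega>) + e2ennreal (- U' \<omega>)) * indicator D \<omega> \<partial>P z) =
    emeasure (P z) D * (ennreal a * ((\<integral>\<^sup>+\<omega>. e2ennreal (\<Phi> (\<lambda>i. Z i \<omega>)) \<partial>P y) +
      (\<integral>\<^sup>+\<omega>. e2ennreal (- \<Phi>' (\<lambda>i. Z i \<omega>)) \<partial>P y)))"
proof -
  have [measurable]: "(\<lambda>\<omega> i. Z i \<omega>) \<in> measurable (P y) path_space"
    unfolding law_measurable by (rule measurable_path) (rule Z_measurable)
  let ?f = "\<lambda>f. ennreal a * (e2ennreal (\<Phi> f) + e2ennreal (- \<Phi>' f))"
  have "(\<integral>\<^sup>+\<omega>. (e2ennreal (U \<omega>) + e2ennreal (- U' \<omega>)) * indicator D \<omega> \<partial>P z) =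
      (\<integral>\<^sup>+\<omega>. ?f (\<lambda>i. Z (n + i) \<omega>) * indicator D \<omega> \<partial>P z)"
  proof (rule nn_integral_cong)
    fix \<omega>
    have "e2ennreal (U \<omega>) + e2ennreal (- U' \<omega>) = ?f (\<lambda>i. Z (n + i) \<omega>)" if "\<omega> \<in> D"
    proof -
      have "- U' \<omega> = ereal a * - \<Phi>' (\<lambda>i. Z (n + i) \<omega>)"
        unfolding U(2)[OF that] by simp
      then show ?thesis
        unfolding U(1)[OF that] by (simp only: e2ennreal_mult[OF a] distrib_left)
    qed
    then show "(e2ennreal (U \<omega>) + e2ennreal (- U' \<omega>)) * indicator D \<omega> =
        ?f (\<lambda>i. Z (n + i) \<omega>) * indicator D \<omega>"
      by (cases "\<omega> \<in> D") simp_all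
  qed
  also have "\<dots> = emeasure (P z) D * (\<integral>\<^sup>+\<omega>. ?f (\<lambda>i. Z i \<omega>) \<partial>P y)"
    by (rule nn_integral_future[OF D]) measurable
  also have "(\<integral>\<^sup>+\<omega>. ?f (\<lambda>i. Z i \<omega>) \<partial>P y) =
      ennreal a * (\<integral>\<^sup>+\<omega>. e2ennreal (\<Phi> (\<lambda>i. Z i \<omega>)) + e2ennreal (- \<Phi>' (\<lambda>i. Z i \<omega>)) \<partial>P y)"
    by (rule nn_integral_cmult) measurable
  also have "(\<integral>\<^sup>+\<omega>. e2ennreal (\<Phi> (\<lambda>i. Z i \<omega>)) + e2ennreal (- \<Phi>' (\<lambda>i. Z i \<omega>)) \<partial>P y) =
      (\<integral>\<^sup>+\<omega>. e2ennreal (\<Phi> (\<lambda>i. Z i \<omega>)) \<partial>P y) + (\<integral>\<^sup>+\<omega>. e2ennreal (- \<Phi>' (\<lambda>i. Z i \<omega>)) \<partial>P y)"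
    by (rule nn_integral_add) measurable
  finally show ?thesis .
qed

text \<open>Both sides are the corresponding sums under \<open>P y\<close> times the same constant,
  so the order is inherited.\<close>

lemma nn_integral_future_pos_neg_le:
  fixes U U' :: "'w \<Rightarrow> ereal" and \<Phi> \<Phi>' :: "(nat \<Rightarrow> 's) \<Rightarrow> ereal"
  assumes le: "(\<integral>\<^sup>+\<omega>. e2ennreal (\<Phi> (\<lambda>i. Z i \<omega>)) \<partial>P y) + (\<integral>\<^sup>+\<omega>. e2ennreal (- \<Phi>' (\<lambda>i. Z i \<omega>)) \<partial>P y)
      \<le> (\<integral>\<^sup>+\<omega>. e2ennreal (\<Phi>' (\<lambda>i. Z i \<omega>)) \<partial>P y) + (\<integral>\<^sup>+\<omega>. e2ennreal (- \<Phi> (\<lambda>i. Z i \<omega>)) \<partial>P y)"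
    and D: "D \<in> sets (\<A> n)" "D \<subseteq> {\<omega>. Z n \<omega> = y}" and a: "0 \<le> a"
    and \<Phi>: "\<Phi> \<in> borel_measurable path_space" "\<Phi>' \<in> borel_measurable path_space"
    and U: "\<And>\<omega>. \<omega> \<in> D \<Longrightarrow> U \<omega> = ereal a * \<Phi> (\<lambda>i. Z (n + i) \<omega>)"
    and U': "\<And>\<omega>. \<omega> \<in> D \<Longrightarrow> U' \<omega> = ereal a * \<Phi>' (\<lambda>i. Z (n + i) \<omega>)"
  shows "(\<integral>\<^sup>+\<omega>. (e2ennreal (U \<omega>) + e2ennreal (- U' \<omega>)) * indicator D \<omega> \<partial>P z)
    \<le> (\<integral>\<^sup>+\<omega>. (e2ennreal (U' \<omega>) + e2ennreal (- U \<omega>)) * indicator D \<omega> \<partial>P z)"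
  using nn_integral_future_pos_neg[where U=U and U'=U' and z=z, OF D a \<Phi> U U']
    nn_integral_future_pos_neg[where U=U' and U'=U and z=z, OF D a \<Phi>(2,1) U' U]
    mult_left_mono[OF mult_left_mono[OF le, of "ennreal a"], of "emeasure (P z) D"]
  by simp

end

section \<open>Comparing rules through their continuations\<close>

locale stopping_problem = markov_chain M \<A> P K Z
  for M :: "'w measure" and \<A> :: "nat \<Rightarrow> 'w measure"
    and P :: "'s::countable \<Rightarrow> 'w measure" and K :: "'s \<Rightarrow> 's pmf" and Z :: "nat \<Rightarrow> 'w \<Rightarrow> 's" +
  fixes g \<alpha> :: "'s \<Rightarrow> real"
  assumes discount_nonneg: "\<And>z. 0 \<le> \<alpha> z"
    and exists: "\<And>\<tau> z. stopping_rule \<A> \<tau> \<Longrightarrow>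
      expectation_exists (P z) (stopped_payoff \<alpha> g Z \<tau>)"
    and continuity: "\<And>z \<sigma> \<tau>. (\<And>n. stopping_rule \<A> (\<sigma> n)) \<Longrightarrow>
      (\<And>n \<omega>. \<omega> \<in> space M \<Longrightarrow> \<sigma> n \<omega> \<le> \<sigma> (Suc n) \<omega>) \<Longrightarrow>
      (\<And>\<omega>. \<omega> \<in> space M \<Longrightarrow> (\<lambda>n. \<sigma> n \<omega>) \<longlonglongrightarrow> \<tau> \<omega>) \<Longrightarrow>
      (\<lambda>n. ereal_expectation (P z) (stopped_payoff \<alpha> g Z (\<sigma> n))) \<longlonglongrightarrow>
        ereal_expectation (P z) (stopped_payoff \<alpha> g Z \<tau>)"
begin

abbreviation val :: "'s \<Rightarrow> ('w \<Rightarrow> enat) \<Rightarrow> ereal" where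
  "val z \<tau> \<equiv> ereal_expectation (P z) (stopped_payoff \<alpha> g Z \<tau>)"

lemma stopped_payoff_path:
  "stopped_payoff \<alpha> g Z (\<lambda>\<omega>. r (\<lambda>i. Z i \<omega>)) \<omega> = stopped_payoff \<alpha> g (\<lambda>i f. f i) r (\<lambda>i. Z i \<omega>)"
  by (simp add: stopped_payoff_def payoff_def split: enat.split)

lemma val_cong:
  assumes "\<And>\<omega>. \<omega> \<in> space M \<Longrightarrow> \<sigma> \<omega> = \<tau> \<omega>"
  shows "val z \<sigma> = val z \<tau>"
proof -
  have "stopped_payoff \<alpha> g Z \<sigma> \<omega> = stopped_payoff \<alpha> g Z \<tau> \<omega>" if "\<omega> \<in> space M" for \<omega>
    using assms[OF that] by (simp add: stopped_payoff_def)
  then show ?thesis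
    unfolding ereal_expectation_def
    by (intro arg_cong2[where f=minus] arg_cong[where f=enn2ereal] nn_integral_cong) auto
qed

text \<open>This is where the strong Markov property enters: \<open>\<sigma>\<close> and the path up to \<open>\<sigma>\<close> take countably many
  values, and the claim is checked on each of the resulting events.\<close>

lemma val_mono_future:
  assumes \<sigma>: "stopping_rule \<A> \<sigma>" and \<rho>: "stopping_rule \<A> \<rho>" and \<rho>': "stopping_rule \<A> \<rho>'"
    and R: "\<And>n. path_rule (R n)" and R': "\<And>n. path_rule (R' n)"
    and eq: "\<And>\<omega> n. \<omega> \<in> space M \<Longrightarrow> \<sigma> \<omega> = enat n \<Longrightarrow> \<rho> \<omega> = enat n + R n (\<lambda>i. Z (n + i) \<omega>)"
    and eq': "\<And>\<omega> n. \<omega> \<in> space M \<Longrightarrow> \<sigma> \<omega> = enat n \<Longrightarrow> \<rho>' \<omega> = enat n + R' n (\<lambda>i. Z (n + i) \<omega>)"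
    and inf: "\<And>\<omega>. \<omega> \<in> space M \<Longrightarrow> \<sigma> \<omega> = \<infinity> \<Longrightarrow> \<rho> \<omega> = \<rho>' \<omega>"
    and le: "\<And>n y. val y (\<lambda>\<omega>. R n (\<lambda>i. Z i \<omega>)) \<le> val y (\<lambda>\<omega>. R' n (\<lambda>i. Z i \<omega>))"
  shows "val z \<rho> \<le> val z \<rho>'"
proof -
  let ?X = "stopped_payoff \<alpha> g Z \<rho>" and ?X' = "stopped_payoff \<alpha> g Z \<rho>'"
  let ?\<Psi> = "\<lambda>n. stopped_payoff \<alpha> g (\<lambda>i f. f i) (R n)"
  let ?\<Psi>' = "\<lambda>n. stopped_payoff \<alpha> g (\<lambda>i f. f i) (R' n)"
  have [measurable]: "?X \<in> borel_measurable (P z)" "?X' \<in> borel_measurable (P z)"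
    by (rule stopped_payoff_measurable, fact)+
  have \<Psi> [measurable]: "?\<Psi> n \<in> borel_measurable path_space" "?\<Psi>' n \<in> borel_measurable path_space" for n
    by (rule measurable_stopped_payoff[OF measurable_coordinate measurable_path_rule], fact)+
  have path [measurable]: "(\<lambda>\<omega> i. Z i \<omega>) \<in> measurable (P y) path_space" for y
    unfolding law_measurable by (rule measurable_path) (rule Z_measurable)
  \<comment> \<open>A piece of the partition fixes \<open>\<sigma>\<close> and, if it is finite, all
    states up to that time; so the collected discount and the present state are constant on
    it.\<close>
  let ?h = "\<lambda>\<omega>. (\<sigma> \<omega>, case \<sigma> \<omega> of enat n \<Rightarrow> map (\<lambda>i. Z i \<omega>) [0..<Suc n] | \<infinity> \<Rightarrow> [])"
  have h: "?h \<in> measurable (P z) (count_space UNIV)"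
    unfolding law_measurable
  proof (rule measurable_compose_countable[OF _ stopping_rule_measurable[OF \<sigma>]])
    fix t
    have "(\<lambda>\<omega>. case t of enat n \<Rightarrow> map (\<lambda>i. Z i \<omega>) [0..<Suc n] | \<infinity> \<Rightarrow> []) \<in> measurable M (count_space UNIV)"
      by (cases t) (simp_all del: upt_Suc add: measurable_map_list Z_measurable)
    then show "(\<lambda>\<omega>. (t, case t of enat n \<Rightarrow> map (\<lambda>i. Z i \<omega>) [0..<Suc n] | \<infinity> \<Rightarrow> []))
        \<in> measurable M (count_space UNIV)"
      by (rule measurable_compose) simp
  qed
  have "(\<integral>\<^sup>+\<omega>. e2ennreal (?X \<omega>) + e2ennreal (- ?X' \<omega>) \<partial>P z)
      \<le> (\<integral>\<^sup>+\<omega>. e2ennreal (?X' \<omega>) + e2ennreal (- ?X \<omega>) \<partial>P z)"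
  proof (rule nn_integral_partition_mono[OF _ _ h])
    fix c
    let ?D = "{\<omega> \<in> space (P z). ?h \<omega> = c}"
    show "(\<integral>\<^sup>+\<omega>. (e2ennreal (?X \<omega>) + e2ennreal (- ?X' \<omega>)) * indicator ?D \<omega> \<partial>P z)
      \<le> (\<integral>\<^sup>+\<omega>. (e2ennreal (?X' \<omega>) + e2ennreal (- ?X \<omega>)) * indicator ?D \<omega> \<partial>P z)"
    proof (cases "?D = {}")
      case False
      then obtain \<omega>\<^sub>0 where \<omega>\<^sub>0: "\<omega>\<^sub>0 \<in> space M" "c = ?h \<omega>\<^sub>0" by auto
      show ?thesis
      proof (cases "\<sigma> \<omega>\<^sub>0")
        case infinity
        have "?X \<omega> = ?X' \<omega>" if "\<omega> \<in> ?D" for \<omega>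
          using that inf[of \<omega>] infinity \<omega>\<^sub>0(2) by (simp add: stopped_payoff_def)
        then show ?thesis by (intro nn_integral_mono) (auto simp: indicator_def)
      next
        case (enat n)
        define a where "a = (\<Prod>i<n. \<alpha> (Z i \<omega>\<^sub>0))"
        have a: "0 \<le> a" unfolding a_def by (intro prod_nonneg) (simp add: discount_nonneg)
        have D_eq: "?D = {\<omega> \<in> space M. \<sigma> \<omega> = enat n \<and> (\<forall>i\<le>n. Z i \<omega> = Z i \<omega>\<^sub>0)}"
          using \<omega>\<^sub>0 enat by (auto simp: less_Suc_eq_le simp del: upt_Suc)
        have "Measurable.pred (\<A> n) (\<lambda>\<omega>. \<sigma> \<omega> = enat n)"
          by (rule stopping_rule_eq[OF \<sigma> order_refl])
        moreover have "Measurable.pred (\<A> n) (\<lambda>\<omega>. \<forall>i\<le>n. Z i \<omega> = Z i \<omega>\<^sub>0)"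
        proof -
          have "Measurable.pred (\<A> n) (\<lambda>\<omega>. \<exists>i\<le>n. Z i \<omega> \<in> - {Z i \<omega>\<^sub>0})"
            by (rule pred_Ex_le[where Q="\<lambda>i \<omega>. Z i \<omega> \<in> - {Z i \<omega>\<^sub>0}"]) (rule Z_in_filtration)
          moreover have "(\<lambda>\<omega>. \<forall>i\<le>n. Z i \<omega> = Z i \<omega>\<^sub>0) = (\<lambda>\<omega>. \<not> (\<exists>i\<le>n. Z i \<omega> \<in> - {Z i \<omega>\<^sub>0}))"
            by auto
          ultimately show ?thesis by (simp only: pred_intros_logic(2))
        qed
        ultimately have "{\<omega> \<in> space (\<A> n). \<sigma> \<omega> = enat n \<and> (\<forall>i\<le>n. Z i \<omega> = Z i \<omega>\<^sub>0)} \<in> sets (\<A> n)"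
          by (intro predE pred_intros_logic(3))
        then have D: "?D \<in> sets (\<A> n)" unfolding D_eq space_F .
        have D_Z: "?D \<subseteq> {\<omega>. Z n \<omega> = Z n \<omega>\<^sub>0}" unfolding D_eq by blast
        have weight: "(\<Prod>i<n. \<alpha> (Z i \<omega>)) = a" if "\<omega> \<in> ?D" for \<omega>
          unfolding a_def using that unfolding D_eq by (intro prod.cong) auto
        have X: "?X \<omega> = ereal a * ?\<Psi> n (\<lambda>i. Z (n + i) \<omega>)" if "\<omega> \<in> ?D" for \<omega>
          using stopped_payoff_shift[where \<alpha>=\<alpha> and \<rho>=\<rho> and r="R n" and Z=Z, OF discount_nonneg eq[of \<omega> n], where g=g]
            that D_eq weight[OF that] by auto
        have X': "?X' \<omega> = ereal a * ?\<Psi>' n (\<lambda>i. Z (n + i) \<omega>)" if "\<omega> \<in> ?D" for \<omega>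
          using stopped_payoff_shift[where \<alpha>=\<alpha> and \<rho>=\<rho>' and r="R' n" and Z=Z, OF discount_nonneg eq'[of \<omega> n], where g=g]
            that D_eq weight[OF that] by auto
        let ?y = "Z n \<omega>\<^sub>0"
        have "(\<integral>\<^sup>+\<omega>. e2ennreal (?\<Psi> n (\<lambda>i. Z i \<omega>)) \<partial>P ?y) + (\<integral>\<^sup>+\<omega>. e2ennreal (- ?\<Psi>' n (\<lambda>i. Z i \<omega>)) \<partial>P ?y)
            \<le> (\<integral>\<^sup>+\<omega>. e2ennreal (?\<Psi>' n (\<lambda>i. Z i \<omega>)) \<partial>P ?y) + (\<integral>\<^sup>+\<omega>. e2ennreal (- ?\<Psi> n (\<lambda>i. Z i \<omega>)) \<partial>P ?y)"
          using le[of ?y n]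
          unfolding ereal_expectation_le_iff[OF exists[OF stopping_rule_path[OF R]] exists[OF stopping_rule_path[OF R']]]
            stopped_payoff_path .
        then show ?thesis
          by (rule nn_integral_future_pos_neg_le[OF _ D D_Z a \<Psi>(1) \<Psi>(2)]) (fact X, fact X')
      qed
    next
      case True
      show ?thesis unfolding True by simp
    qed
  qed measurable
  then show ?thesis
    unfolding ereal_expectation_le_iff[OF exists[OF \<rho>] exists[OF \<rho>']]
    by (subst (asm) (1 2) nn_integral_add) auto
qed

lemma val_AE_cong:
  assumes "AE \<omega> in P z. \<sigma> \<omega> = \<tau> \<omega>"
  shows "val z \<sigma> = val z \<tau>"
proof -
  have "AE \<omega> in P z. stopped_payoff \<alpha> g Z \<sigma> \<omega> = stopped_payoff \<alpha> g Z \<tau> \<omega>"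
    using assms by eventually_elim (simp add: stopped_payoff_def)
  then have "AE \<omega> in P z. e2ennreal (stopped_payoff \<alpha> g Z \<sigma> \<omega>) = e2ennreal (stopped_payoff \<alpha> g Z \<tau> \<omega>)"
    "AE \<omega> in P z. e2ennreal (- stopped_payoff \<alpha> g Z \<sigma> \<omega>) = e2ennreal (- stopped_payoff \<alpha> g Z \<tau> \<omega>)"
    by auto
  then show ?thesis
    unfolding ereal_expectation_def by (simp cong: nn_integral_cong_AE)
qed

text \<open>Under \<open>P y\<close> the chain starts in \<open>y\<close> almost surely, so a choice
  made from the initial state is the choice for \<open>y\<close>.\<close>

lemma val_path_start:
  "val y (\<lambda>\<omega>. R (Z 0 \<omega>) (\<lambda>i. Z i \<omega>)) = val y (\<lambda>\<omega>. R y (\<lambda>i. Z i \<omega>))"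
  by (rule val_AE_cong) (use start[of y] in eventually_elim, simp)

text \<open>Turns the inequalities for \<open>g\<close> in \<open>star_set\<close> into comparisons
  with the rule of stopping at once.\<close>

lemma val_0: "val y (\<lambda>_. 0) = ereal (g y)"
proof -
  interpret prob_space "P y" by (rule prob_space_law)
  have AE: "AE \<omega> in P y. stopped_payoff \<alpha> g Z (\<lambda>_. 0) \<omega> = ereal (g y)"
    using start[of y] by eventually_elim (simp add: stopped_payoff_def payoff_def zero_enat_def)
  have "(\<integral>\<^sup>+\<omega>. e2ennreal (stopped_payoff \<alpha> g Z (\<lambda>_. 0) \<omega>) \<partial>P y) = (\<integral>\<^sup>+\<omega>. ennreal (g y) \<partial>P y)"
    using AE by (intro nn_integral_cong_AE) auto
  moreover have "(\<integral>\<^sup>+\<omega>. e2ennreal (- stopped_payoff \<alpha> g Z (\<lambda>_. 0) \<omega>) \<partial>P y) = (\<integral>\<^sup>+\<omega>. ennreal (- g y) \<partial>P y)"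
    using AE by (intro nn_integral_cong_AE) auto
  ultimately show ?thesis
    using emeasure_space_1
    by (cases "0 \<le> g y") (auto simp: ereal_expectation_def ennreal_neg zero_ennreal.rep_eq)
qed

end

subsection \<open>Forward improvement\<close>

context stopping_problem
begin

lemma val_mono_continue:
  assumes "stopping_rule \<A> \<sigma>" "path_rule r" "path_rule r'"
    and "\<And>y. val y (\<lambda>\<omega>. r (\<lambda>i. Z i \<omega>)) \<le> val y (\<lambda>\<omega>. r' (\<lambda>i. Z i \<omega>))"
  shows "val z (continue Z \<sigma> r) \<le> val z (continue Z \<sigma> r')"
  by (rule val_mono_future[where \<sigma>=\<sigma> and R="\<lambda>_. r" and R'="\<lambda>_. r'"])
    (use assms in \<open>simp_all add: stopping_rule_continue continue_def\<close>)

text \<open>Stopping a skip to the \<open>l\<close>-th time or later at an intermediate visit of \<open>B\<^sup>*\<^sup>k\<close> does not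
  lose anything: the remaining skip has length at most \<open>k\<close>.\<close>

lemma val_skip_min:
  fixes B k
  defines "B' \<equiv> star_set P \<alpha> g Z k B"
  assumes l: "1 \<le> l" "l \<le> k"
  shows "val z (entrance_from Z l B) \<le> val z (\<lambda>\<omega>. min (entrance_from Z l B \<omega>) (entrance_from Z 1 B' \<omega>))"
\<comment> \<open>The common time is the truncated skip, which has nothing left to do. The full
  skip, cut at a visit of \<open>B'\<close> at some time \<open>n < l\<close>, still has to wait
  \<open>l - n\<close> steps and then for \<open>B\<close>; otherwise it has ended too.\<close>
proof (rule val_mono_future[where \<sigma>="\<lambda>\<omega>. min (entrance_from Z l B \<omega>) (entrance_from Z 1 B' \<omega>)"
      and R'="\<lambda>_ _. 0"
      and R="\<lambda>n f. if f 0 \<in> B' \<and> 0 < n \<and> n < l then path_entrance (l - n) B f else 0"])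
  have B': "B' \<subseteq> B" unfolding B'_def by (rule star_set_subset)
  fix \<omega> n assume n: "min (entrance_from Z l B \<omega>) (entrance_from Z 1 B' \<omega>) = enat n"
  show "entrance_from Z l B \<omega> = enat n + (if Z (n + 0) \<omega> \<in> B' \<and> 0 < n \<and> n < l
      then path_entrance (l - n) B (\<lambda>i. Z (n + i) \<omega>) else 0)"
  proof (cases "entrance_from Z l B \<omega> = enat n")
    case True
    then have "l \<le> n" using entrance_ge[of "\<lambda>_. enat l" \<omega> Z B] by simp
    with True show ?thesis by simp
  next
    case False
    with n have e: "entrance_from Z 1 B' \<omega> = enat n" "enat n \<le> entrance_from Z l B \<omega>"
      by (auto simp: min_def split: if_splits)
    from entrance_enatD[OF e(1)] have 1: "1 \<le> n" "Z n \<omega> \<in> B'" by auto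
    \<comment> \<open>A visit of \<open>B'\<close> at time \<open>l\<close> or later would be a
      visit of \<open>B\<close> that ends the skip.\<close>
    have "n < l"
    proof (rule ccontr)
      assume "\<not> n < l"
      with 1 B' have "entrance_from Z l B \<omega> \<le> enat n" by (intro entrance_le) auto
      with e(2) False show False by simp
    qed
    with 1 show ?thesis by (simp add: path_entrance_shift)
  qed
next
  fix n y
  show "val y (\<lambda>\<omega>. if Z 0 \<omega> \<in> B' \<and> 0 < n \<and> n < l then path_entrance (l - n) B (\<lambda>i. Z i \<omega>) else 0)
      \<le> val y (\<lambda>\<omega>. 0)"
    unfolding val_path_start[where R="\<lambda>x f. if x \<in> B' \<and> 0 < n \<and> n < l then path_entrance (l - n) B f else 0"]
  proof (cases "y \<in> B' \<and> 0 < n \<and> n < l")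
    case True
    \<comment> \<open>The star set compares \<open>g\<close> with skips of every length from 1 to
      \<open>k\<close>, hence also with this remainder.\<close>
    then have "l - n \<in> {1..k}" using l by auto
    with True have "val y (entrance_from Z (l - n) B) \<le> ereal (g y)"
      by (auto simp: B'_def star_set_def)
    with True show "val y (\<lambda>\<omega>. if y \<in> B' \<and> 0 < n \<and> n < l then path_entrance (l - n) B (\<lambda>i. Z i \<omega>) else 0)
        \<le> val y (\<lambda>\<omega>. 0)"
      by (simp add: val_0 path_entrance)
  qed auto
next
  fix n
  show "path_rule (\<lambda>f. if f 0 \<in> B' \<and> 0 < n \<and> n < l then path_entrance (l - n) B f else 0)"
  proof (rule path_rule_start[where R="\<lambda>x f. if x \<in> B' \<and> 0 < n \<and> n < l then path_entrance (l - n) B f else 0"])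
    show "path_rule (\<lambda>f. if x \<in> B' \<and> 0 < n \<and> n < l then path_entrance (l - n) B f else 0)" for x
      by (rule path_rule_If[OF path_rule_entrance path_rule_0])
  qed
next
  fix \<omega> assume "min (entrance_from Z l B \<omega>) (entrance_from Z 1 B' \<omega>) = \<infinity>"
  then show "entrance_from Z l B \<omega> = min (entrance_from Z l B \<omega>) (entrance_from Z 1 B' \<omega>)"
    by (simp add: min_def split: if_splits)
qed (simp_all add: stopping_rule_entrance stopping_rule_const stopping_rule_min path_rule_0)

text \<open>Each round outside \<open>B'\<close> advances by at least one step and never passes the
  first visit of \<open>B'\<close>. So after \<open>n\<close> rounds that visit or at least time
  \<open>n\<close> is reached, which yields the convergence needed for continuity.\<close>

lemma val_le_val_entrance_star:
  fixes B k
  defines "B' \<equiv> star_set P \<alpha> g Z k B"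
  assumes \<tau>: "\<tau> \<in> stopping_rules_in M \<A> Z B"
  shows "val z \<tau> \<le> val z (entrance Z \<tau> B')"
proof -
  have B': "B' \<subseteq> B" unfolding B'_def by (rule star_set_subset)
  have "\<exists>l\<in>{1..k}. ereal (g y) < val y (entrance_from Z l B)" if "y \<in> B - B'" for y
    using that by (auto simp: B'_def star_set_def not_le)
  then obtain l where l: "y \<in> B - B' \<Longrightarrow> 1 \<le> l y \<and> l y \<le> k \<and> ereal (g y) < val y (entrance_from Z (l y) B)" for y
    by (metis atLeastAtMost_iff)
  \<comment> \<open>From \<open>x\<close> a skip of length \<open>l x\<close> beats stopping; the
    minimum keeps it from running past the next visit of \<open>B'\<close>.\<close>
  define r where "r x f = (if x \<in> B - B' then min (path_entrance (l x) B f) (path_entrance 1 B' f) else 0)"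
    for x f
  have r: "path_rule (\<lambda>f. r (f 0) f)"
  proof (rule path_rule_start[where R=r])
    show "path_rule (r x)" for x
      unfolding r_def[abs_def]
      by (rule path_rule_If[OF path_rule_min[OF path_rule_entrance path_rule_entrance] path_rule_0])
  qed
  have r_le: "val y (\<lambda>\<omega>. 0) \<le> val y (\<lambda>\<omega>. r (Z 0 \<omega>) (\<lambda>i. Z i \<omega>))" for y
    unfolding val_path_start[where R=r]
  proof (cases "y \<in> B - B'")
    case True
    then have "ereal (g y) \<le> val y (entrance_from Z (l y) B)" using l by (simp add: less_imp_le)
    also have "\<dots> \<le> val y (\<lambda>\<omega>. min (entrance_from Z (l y) B \<omega>) (entrance_from Z 1 B' \<omega>))"
      unfolding B'_def using l[OF True] by (intro val_skip_min) auto
    finally show "val y (\<lambda>\<omega>. 0) \<le> val y (\<lambda>\<omega>. r y (\<lambda>i. Z i \<omega>))"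
      using True by (simp add: r_def val_0 path_entrance)
  qed (auto simp: r_def)
  define \<rho> where "\<rho> = rec_nat \<tau> (\<lambda>_ \<sigma>. continue Z \<sigma> (\<lambda>f. r (f 0) f))"
  have \<rho>_0: "\<rho> 0 = \<tau>" and \<rho>_Suc: "\<rho> (Suc n) = continue Z (\<rho> n) (\<lambda>f. r (f 0) f)" for n
    by (simp_all add: \<rho>_def)
  have \<rho>: "stopping_rule \<A> (\<rho> n)" for n
    by (induction n) (use \<tau> r in \<open>simp_all add: \<rho>_0 \<rho>_Suc stopping_rule_continue stopping_rules_inD(1)\<close>)
  have "val z (\<rho> n) \<le> val z (\<rho> (Suc n))" for n
    using val_mono_continue[OF \<rho>[of n] path_rule_0 r r_le, of z]
    by (simp add: \<rho>_Suc continue_0[abs_def])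
  then have inc: "val z \<tau> \<le> val z (\<rho> n)" for n
    using lift_Suc_mono_le[of "\<lambda>n. val z (\<rho> n)" 0 n] by (simp add: \<rho>_0)
  \<comment> \<open>Membership in \<open>B\<close> is part of the invariant because \<open>r\<close>
    moves on only from \<open>B - B'\<close>; elsewhere the iteration would halt before its
    target.\<close>
  have inv: "\<tau> \<omega> \<le> \<rho> n \<omega> \<and> \<rho> n \<omega> \<le> entrance Z \<tau> B' \<omega> \<and> min (enat n) (entrance Z \<tau> B' \<omega>) \<le> \<rho> n \<omega> \<and>
      (\<forall>m. \<rho> n \<omega> = enat m \<longrightarrow> Z m \<omega> \<in> B)" if \<omega>: "\<omega> \<in> space M" for n \<omega>
  proof (induction n)
    case 0
    then show ?case
      using stopping_rules_inD(2)[OF \<tau> \<omega>] by (simp add: \<rho>_0 entrance_ge zero_enat_def[symmetric])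
  next
    case (Suc n)
    let ?W = "entrance Z \<tau> B' \<omega>"
    show ?case
    proof (cases "\<rho> n \<omega>")
      case infinity
      with Suc.IH show ?thesis by (simp add: \<rho>_Suc continue_def)
    next
      case (enat m)
      with Suc.IH have m: "\<tau> \<omega> \<le> enat m" "enat m \<le> ?W" "min (enat n) ?W \<le> enat m" "Z m \<omega> \<in> B" by auto
      show ?thesis
      proof (cases "Z m \<omega> \<in> B'")
        case True
        with m have "?W = enat m" by (intro antisym entrance_le)
        moreover have "\<rho> (Suc n) \<omega> = enat m" using True by (simp add: \<rho>_Suc continue_def enat r_def)
        ultimately show ?thesis using m by simp
      next
        case False
        have \<rho>_eq: "\<rho> (Suc n) \<omega> = min (entrance_from Z (m + l (Z m \<omega>)) B \<omega>) (entrance_from Z (m + 1) B' \<omega>)"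
          using False m(4)
          by (simp add: \<rho>_Suc continue_def enat r_def enat_add_min path_entrance_shift)
        have W: "enat m < ?W" using m(2) False entrance_enatD(2)[of Z \<tau> B' \<omega> m] by (auto simp: less_le)
        \<comment> \<open>The target, if finite, is a visit of \<open>B'\<close> after time
          \<open>m\<close>, so it bounds the first such visit.\<close>
        have "entrance_from Z (m + 1) B' \<omega> \<le> ?W"
          using W by (cases ?W) (auto intro!: entrance_le dest: entrance_enatD)
        then have 1: "\<rho> (Suc n) \<omega> \<le> ?W" by (simp add: \<rho>_eq min_le_iff_disj)
        have "enat (Suc m) \<le> enat (m + l (Z m \<omega>))" using l[of "Z m \<omega>"] False m(4) by simp
        then have 2: "enat (Suc m) \<le> \<rho> (Suc n) \<omega>"
          using entrance_ge[of "\<lambda>_. enat (m + l (Z m \<omega>))" \<omega> Z B] entrance_ge[of "\<lambda>_. enat (m + 1)" \<omega> Z B']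
          by (simp add: \<rho>_eq order_trans[where y="enat (m + l (Z m \<omega>))"])
        \<comment> \<open>The target is not yet reached, so the lower bound from the previous round
          is \<open>n\<close> itself; the strict advance raises it to \<open>Suc n\<close>.\<close>
        have "n \<le> m" using m(3) W by (auto simp: min_le_iff_disj)
        then have 3: "min (enat (Suc n)) ?W \<le> \<rho> (Suc n) \<omega>"
          using order_trans[OF _ 2, of "enat (Suc n)"] by (simp add: min_le_iff_disj)
        have 4: "Z i \<omega> \<in> B" if "\<rho> (Suc n) \<omega> = enat i" for i
          using that B' by (auto simp: \<rho>_eq min_def split: if_splits dest: entrance_enatD)
        have "\<tau> \<omega> \<le> \<rho> (Suc n) \<omega>" using m(1) 2 by (meson enat_ord_simps(1) le_SucI order_refl order_trans)
        with 1 3 4 show ?thesis by simp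
      qed
    qed
  qed
  have "(\<lambda>n. val z (\<rho> n)) \<longlonglongrightarrow> val z (entrance Z \<tau> B')"
  proof (rule continuity[OF \<rho>])
    show "\<rho> n \<omega> \<le> \<rho> (Suc n) \<omega>" for n \<omega> by (simp add: \<rho>_Suc continue_ge)
    show "(\<lambda>n. \<rho> n \<omega>) \<longlonglongrightarrow> entrance Z \<tau> B' \<omega>" if "\<omega> \<in> space M" for \<omega>
      by (rule enat_tendsto_sandwich) (use inv[OF that] in auto)
  qed
  then show ?thesis by (rule LIMSEQ_le_const) (use inc in auto)
qed

section \<open>Truncation at the successive visits of \<open>F\<close>\<close>

lemma val_le_val_entrance:
  assumes F: "\<And>y. y \<in> F \<Longrightarrow> val y (entrance_from Z 1 F) \<le> ereal (g y)"
    and \<tau>: "\<tau> \<in> stopping_rules_in M \<A> Z F"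
  shows "val z \<tau> \<le> val z (entrance_from Z 0 F)"
proof -
  note \<tau>_rule = stopping_rules_inD(1)[OF \<tau>]
  \<comment> \<open>\<open>T n\<close> is visit number \<open>n\<close> of \<open>F\<close>, counted
    from 0: the first may occur at time 0, each later one strictly after its predecessor.\<close>
  define T where "T = rec_nat (entrance_from Z 0 F) (\<lambda>_ \<sigma>. continue Z \<sigma> (path_entrance 1 F))"
  have T_0: "T 0 = entrance_from Z 0 F" and T_Suc: "T (Suc n) = continue Z (T n) (path_entrance 1 F)" for n
    by (simp_all add: T_def)
  have T: "stopping_rule \<A> (T n)" for n
    by (induction n)
      (simp_all add: T_0 T_Suc stopping_rule_continue path_rule_entrance stopping_rule_entrance stopping_rule_const)
  have T_next: "T (Suc n) \<omega> = entrance_from Z (m + 1) F \<omega>" if "T n \<omega> = enat m" for n m \<omega>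
    using that path_entrance_shift[of m 1 F Z \<omega>] by (simp add: T_Suc continue_def)
  have T_ge: "enat n \<le> T n \<omega>" for n \<omega>
  proof (induction n)
    case (Suc n)
    show ?case
    proof (cases "T n \<omega>")
      case (enat m)
      have "enat (Suc n) \<le> enat (m + 1)" using Suc enat by simp
      also have "\<dots> \<le> T (Suc n) \<omega>" unfolding T_next[OF enat] by (rule entrance_ge)
      finally show ?thesis .
    qed (simp add: T_Suc continue_def)
  qed (simp add: zero_enat_def[symmetric])
  \<comment> \<open>These rules increase to \<open>\<tau>\<close>, yet their values decrease: where
    visit number \<open>n\<close> precedes \<open>\<tau>\<close>, the next rule waits for another
    visit, which by hypothesis \<open>F\<close> is no better than stopping. Elsewhere both rules
    equal \<open>\<tau>\<close>.\<close>
  let ?\<rho> = "\<lambda>n \<omega>. min (\<tau> \<omega>) (T n \<omega>)"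
  have \<rho>: "stopping_rule \<A> (?\<rho> n)" for n by (rule stopping_rule_min[OF \<tau>_rule T])
  have "val z (?\<rho> (Suc n)) \<le> val z (?\<rho> n)" for n
  proof (rule val_mono_future[OF stopping_rule_restrict[OF T \<tau>_rule] \<rho> \<rho>])
    fix \<omega> m assume \<omega>: "\<omega> \<in> space M" and "(if T n \<omega> < \<tau> \<omega> then T n \<omega> else \<infinity>) = enat m"
    then have m: "T n \<omega> = enat m" "enat m < \<tau> \<omega>" by (auto split: if_splits)
    show "min (\<tau> \<omega>) (T n \<omega>) = enat m + 0" using m by simp
    have "Z m \<omega> \<in> F"
    proof (cases n)
      case 0
      then show ?thesis using m(1) by (auto simp: T_0 dest: entrance_enatD)
    next
      case (Suc n')
      then obtain m' where "T n' \<omega> = enat m'" using m(1) by (cases "T n' \<omega>") (auto simp: T_Suc continue_def)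
      from T_next[OF this] m(1) have "entrance_from Z (m' + 1) F \<omega> = enat m" by (simp add: Suc)
      then show ?thesis by (rule entrance_enatD)
    qed
    \<comment> \<open>As \<open>\<tau>\<close> stops only in \<open>F\<close>, it cannot stop
      strictly between consecutive visits; the next truncation is therefore the next visit
      itself.\<close>
    moreover have "T (Suc n) \<omega> \<le> \<tau> \<omega>"
      unfolding T_next[OF m(1)]
      using m(2) stopping_rules_inD(2)[OF \<tau> \<omega>] by (cases "\<tau> \<omega>") (auto intro!: entrance_le)
    ultimately show "min (\<tau> \<omega>) (T (Suc n) \<omega>) =
        enat m + (if Z (m + 0) \<omega> \<in> F then path_entrance 1 F (\<lambda>i. Z (m + i) \<omega>) else 0)"
      by (simp add: T_Suc continue_def m(1) min_absorb2)
  next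
    fix \<omega> assume "(if T n \<omega> < \<tau> \<omega> then T n \<omega> else \<infinity>) = \<infinity>"
    then have "\<tau> \<omega> \<le> T n \<omega>" by (auto split: if_splits)
    moreover have "T n \<omega> \<le> T (Suc n) \<omega>" by (simp add: T_Suc continue_ge)
    ultimately show "min (\<tau> \<omega>) (T (Suc n) \<omega>) = min (\<tau> \<omega>) (T n \<omega>)" by (simp add: min_absorb1)
  next
    fix y
    show "val y (\<lambda>\<omega>. if Z 0 \<omega> \<in> F then path_entrance 1 F (\<lambda>i. Z i \<omega>) else 0) \<le> val y (\<lambda>\<omega>. 0)"
      unfolding val_path_start[where R="\<lambda>x f. if x \<in> F then path_entrance 1 F f else 0"]
      using F[of y] by (cases "y \<in> F") (simp_all add: val_0 path_entrance)
    show "path_rule (\<lambda>f. if f 0 \<in> F then path_entrance 1 F f else 0)"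
      by (rule path_rule_start[where R="\<lambda>x f. if x \<in> F then path_entrance 1 F f else 0"])
        (rule path_rule_If[OF path_rule_entrance path_rule_0])
  qed (rule path_rule_0)
  then have dec: "val z (?\<rho> n) \<le> val z (?\<rho> 0)" for n
    by (rule lift_Suc_antimono_le[of "\<lambda>n. val z (?\<rho> n)"]) simp
  have "(\<lambda>n. val z (?\<rho> n)) \<longlonglongrightarrow> val z \<tau>"
  proof (rule continuity[OF \<rho>])
    show "?\<rho> n \<omega> \<le> ?\<rho> (Suc n) \<omega>" for n \<omega>
      by (rule min.mono) (simp_all add: T_Suc continue_ge)
    show "(\<lambda>n. ?\<rho> n \<omega>) \<longlonglongrightarrow> \<tau> \<omega>" for \<omega>
      by (rule enat_tendsto_sandwich) (use T_ge[of _ \<omega>] in \<open>auto simp: min_le_iff_disj\<close>)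
  qed
  then have "val z \<tau> \<le> val z (?\<rho> 0)" by (rule LIMSEQ_le_const2) (use dec in auto)
  also have "\<dots> = val z (entrance_from Z 0 F)"
  proof (rule val_cong)
    fix \<omega> assume "\<omega> \<in> space M"
    then have "T 0 \<omega> \<le> \<tau> \<omega>" unfolding T_0
      using stopping_rules_inD(2)[OF \<tau>] by (cases "\<tau> \<omega>") (auto intro!: entrance_le)
    then show "?\<rho> 0 \<omega> = entrance_from Z 0 F \<omega>" by (simp add: T_0 min_absorb2)
  qed
  finally show ?thesis .
qed

end

section \<open>Optimality of the entrance time of the limit set\<close>

theorem theorem2p2:
  fixes M :: "'w measure" and \<A> :: "nat \<Rightarrow> 'w measure"
    and P :: "'s::countable \<Rightarrow> 'w measure" and K :: "'s \<Rightarrow> 's pmf"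
    and Z :: "nat \<Rightarrow> 'w \<Rightarrow> 's"
    and g \<alpha> :: "'s \<Rightarrow> real"
    and B0 :: "'s set" and \<kappa> :: "nat \<Rightarrow> nat"
  defines "E \<equiv> \<lambda>z \<tau>. ereal_expectation (P z) (stopped_payoff \<alpha> g Z \<tau>)"
    and "B \<equiv> iter_set P \<alpha> g Z \<kappa> B0"
    and "F \<equiv> (\<Inter>k. iter_set P \<alpha> g Z \<kappa> B0 k)"
  assumes chain: "markov_chain M \<A> P K Z"
    and alpha: "\<And>z. 0 \<le> \<alpha> z \<and> \<alpha> z \<le> 1"
    and exists: "\<And>\<tau> z. stopping_rule \<A> \<tau> \<Longrightarrow>
      expectation_exists (P z) (stopped_payoff \<alpha> g Z \<tau>)"
    and continuity: "\<And>z \<sigma> \<tau>. (\<And>n. stopping_rule \<A> (\<sigma> n)) \<Longrightarrow>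
      (\<And>n \<omega>. \<omega> \<in> space M \<Longrightarrow> \<sigma> n \<omega> \<le> \<sigma> (Suc n) \<omega>) \<Longrightarrow>
      (\<And>\<omega>. \<omega> \<in> space M \<Longrightarrow> (\<lambda>n. \<sigma> n \<omega>) \<longlonglongrightarrow> \<tau> \<omega>) \<Longrightarrow>
      (\<lambda>n. E z (\<sigma> n)) \<longlonglongrightarrow> E z \<tau>"
    and kappa: "\<And>k. 1 \<le> k \<Longrightarrow> 1 \<le> \<kappa> k"
  shows "entrance_from Z 0 F \<in> stopping_rules_in M \<A> Z B0 \<and>
    (\<forall>z. E z (entrance_from Z 0 F) = (SUP \<tau>\<in>stopping_rules_in M \<A> Z B0. E z \<tau>)) \<and>
    (\<forall>k. \<forall>\<omega>\<in>space M. entrance_from Z 0 (B k) \<omega> \<le> entrance_from Z 0 (B (Suc k)) \<omega>) \<and>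
    (\<forall>\<omega>\<in>space M. (\<lambda>k. entrance_from Z 0 (B k) \<omega>) \<longlonglongrightarrow> entrance_from Z 0 F \<omega>) \<and>
    (\<forall>k z. E z (entrance_from Z 0 (B k)) \<le> E z (entrance_from Z 0 (B (Suc k))))"
proof -
  interpret markov_chain M \<A> P K Z by (rule chain)
  interpret stopping_problem M \<A> P K Z g \<alpha>
    by unfold_locales (use alpha exists continuity in \<open>auto simp: E_def\<close>)
  have B_0: "B 0 = B0" and B_Suc: "B (Suc k) = star_set P \<alpha> g Z (\<kappa> (Suc k)) (B k)" for k
    by (simp_all add: B_def)
  have F: "F = (\<Inter>k. B k)" by (simp add: F_def B_def)
  have dec: "decseq B" unfolding decseq_Suc_iff B_Suc by (simp add: star_set_subset)
  have mono: "entrance Z \<sigma> (B k) \<omega> \<le> entrance Z \<sigma> (B (Suc k)) \<omega>" for \<sigma> k \<omega>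
    using dec by (intro entrance_antimono) (simp add: decseq_Suc_iff)
  \<comment> \<open>The entrance into \<open>B k\<close> stops in \<open>B k\<close>, so it can be
    improved; continuing from it to the next set is the same as entering that set directly after
    \<open>\<sigma>\<close>.\<close>
  have step: "E z (entrance Z \<sigma> (B k)) \<le> E z (entrance Z \<sigma> (B (Suc k)))"
    if "stopping_rule \<A> \<sigma>" for z \<sigma> k
    using val_le_val_entrance_star[OF entrance_in[OF that], where k="\<kappa> (Suc k)" and B="B k" and z=z]
    by (simp add: E_def B_Suc entrance_entrance[OF star_set_subset, abs_def])
  have lim: "(\<lambda>k. E z (entrance Z \<sigma> (B k))) \<longlonglongrightarrow> E z (entrance Z \<sigma> F)"
    if "stopping_rule \<A> \<sigma>" for z \<sigma>
    unfolding F E_def by (rule continuity) (simp_all add: stopping_rule_entrance that mono entrance_Inter dec)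
  \<comment> \<open>A point of \<open>F\<close> lies in every \<open>B (Suc k)\<close>, where
    \<open>l = 1\<close> is among the inequalities because \<open>\<kappa>\<close> is at least 1.
    Continuity carries them over from the sets \<open>B k\<close> to \<open>F\<close>.\<close>
  have F_stop: "val y (entrance_from Z 1 F) \<le> ereal (g y)" if "y \<in> F" for y
  proof -
    have "E y (entrance_from Z 1 (B k)) \<le> ereal (g y)" for k
    proof -
      have "y \<in> B (Suc k)" using that F by auto
      then show ?thesis using kappa[of "Suc k"] by (auto simp: E_def B_Suc star_set_def)
    qed
    then show ?thesis
      using LIMSEQ_le_const2[OF lim[OF stopping_rule_const]] by (auto simp: E_def)
  qed
  have opt: "E z \<tau> \<le> E z (entrance_from Z 0 F)" if \<tau>: "\<tau> \<in> stopping_rules_in M \<A> Z B0" for z \<tau>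
  proof -
    note rule = stopping_rules_inD(1)[OF \<tau>]
    have "E z \<tau> = E z (entrance Z \<tau> (B 0))"
      unfolding E_def by (rule val_cong) (simp add: entrance_self B_0 stopping_rules_inD(2)[OF \<tau>])
    then have "E z \<tau> \<le> E z (entrance Z \<tau> (B k))" for k
      using lift_Suc_mono_le[of "\<lambda>k. E z (entrance Z \<tau> (B k))" 0 k] step[OF rule] by simp
    then have "E z \<tau> \<le> E z (entrance Z \<tau> F)"
      by (intro LIMSEQ_le_const[OF lim[OF rule]]) auto
    also have "\<dots> \<le> E z (entrance_from Z 0 F)"
      unfolding E_def by (rule val_le_val_entrance[OF F_stop entrance_in[OF rule]])
    finally show ?thesis .
  qed
  have "F \<subseteq> B0" using F B_0 by auto
  then have in_B0: "entrance_from Z 0 F \<in> stopping_rules_in M \<A> Z B0"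
    using entrance_in[OF stopping_rule_const, of "enat 0" F] by (auto simp: stopping_rules_in_def)
  have "E z (entrance_from Z 0 F) = (SUP \<tau>\<in>stopping_rules_in M \<A> Z B0. E z \<tau>)" for z
    using in_B0 opt by (intro antisym SUP_upper SUP_least)
  moreover have "(\<lambda>k. entrance_from Z 0 (B k) \<omega>) \<longlonglongrightarrow> entrance_from Z 0 F \<omega>" for \<omega>
    unfolding F by (rule entrance_Inter[OF dec])
  moreover have "E z (entrance_from Z 0 (B k)) \<le> E z (entrance_from Z 0 (B (Suc k)))" for k z
    by (rule step[OF stopping_rule_const])
  ultimately show ?thesis using in_B0 mono by simp
qed

end
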